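(* Let $K$ be a field and let $E$ be a finite directed graph without sinks, with adjacency matrix $A_E$. Then the Leavitt path algebra $L_K(E)$ (with its standard $\mathbb{Z}$-grading) does not have gr-IBN if and only if there exist positive integers $m\neq n$ and nonnegative integers $p_1,\dots,p_m,q_1,\dots,q_n$ such that $$(1,1,\dots,1)\,(A_E^{p_1}+\cdots+A_E^{p_m})=(1,1,\dots,1)\,(A_E^{q_1}+\cdots+A_E^{q_n}),$$ where $(1,1,\dots,1)$ denotes the all-ones row vector of length $|E^0|$.
   Context: A directed graph $E=(E^0,E^1,s,r)$ consists of disjoint sets $E^0$ (vertices) and $E^1$ (edges) with maps $s,r:E^1\to E^0$ (source, range). It is finite if $E^0$ and $E^1$ are finite. A sink is a vertex $v$ with $s^{-1}(v)=\emptyset$; a vertex $v$ is regular if $0<|s^{-1}(v)|<\infty$. If $E^0=\{v_1,\dots,v_h\}$, the adjacency matrix $A_E=(a_{ij})$ is the $h\times h$ matrix with $a_{ij}$ the number of edges $e$ with $s(e)=v_i$, $r(e)=v_j$; $A_E^0$ is the identity matrix. The Leavitt path algebra $L_K(E)$ is the $K$-algebra generated by $E^0\cup E^1\cup\{e^*\mid e\in E^1\}$ subject to, for all $v,w\in E^0$ and $e,f\in E^1$: (1) $vw=\delta_{v,w}w$; (2) $s(e)e=e=er(e)$ and $r(e)e^*=e^*=e^*s(e)$; (3) $e^*f=\delta_{e,f}r(e)$; (4) $v=\sum_{e\in s^{-1}(v)}ee^*$ for every regular vertex $v$. It is $\mathbb{Z}$-graded with $\deg v=0$, $\deg e=1$,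 $\deg e^*=-1$. For an abelian group $\Gamma$, a $\Gamma$-graded ring $R$ and $\delta\in\Gamma$, the shifted graded right module $R(\delta)$ has components $R(\delta)_\gamma=R_{\delta+\gamma}$; $\cong_{gr}$ denotes isomorphism of right modules preserving degrees. $R$ has gr-IBN (Graded Invariant Basis Number) if for all positive integers $m,n$ and all $\alpha_1,\dots,\alpha_m,\beta_1,\dots,\beta_n\in\Gamma$, $R(\alpha_1)\oplus\cdots\oplus R(\alpha_m)\cong_{gr}R(\beta_1)\oplus\cdots\oplus R(\beta_n)$ as graded right $R$-modules implies $m=n$. *)

theory Defs
  imports
    "HOL-Library.Poly_Mapping"
    "HOL-Algebra.QuotRing"
    "Graph_Theory.Digraph"
    "Jordan_Normal_Form.Matrix"
begin

section \<open>Graded right modules and graded invariant basis number\<close>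

text \<open>
  HOL-Algebra only has modules over commutative rings, so right modules graded by a group
  \<open>'g\<close> get their own record. The component of degree \<open>\<gamma>\<close> is \<open>component M \<gamma>\<close>.
\<close>

record ('b, 'a, 'g) graded_right_module = "'b partial_object" +
  madd :: "'b \<Rightarrow> 'b \<Rightarrow> 'b"
  ract :: "'b \<Rightarrow> 'a \<Rightarrow> 'b"
  component :: "'g \<Rightarrow> 'b set"

definition regular_module ::
    "('a, 'c) ring_scheme \<Rightarrow> ('g \<Rightarrow> 'a set) \<Rightarrow> ('a, 'a, 'g) graded_right_module" where
  "regular_module R gr =
     \<lparr>carrier = carrier R, madd = (\<oplus>\<^bsub>R\<^esub>), ract = (\<otimes>\<^bsub>R\<^esub>), component = gr\<rparr>"

definition graded_shift ::
    "('b, 'a, 'g::ab_group_add) graded_right_module \<Rightarrow> 'g \<Rightarrow> ('b, 'a, 'g) graded_right_module" where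
  "graded_shift M \<delta> = M\<lparr>component := \<lambda>\<gamma>. component M (\<delta> + \<gamma>)\<rparr>"

text \<open>The direct sum over a finite index set, realised as extensional families.\<close>

definition direct_sum ::
    "'i set \<Rightarrow> ('i \<Rightarrow> ('b, 'a, 'g) graded_right_module) \<Rightarrow> ('i \<Rightarrow> 'b, 'a, 'g) graded_right_module" where
  "direct_sum I M =
     \<lparr>carrier = (\<Pi>\<^sub>E i\<in>I. carrier (M i)),
      madd = (\<lambda>x y. \<lambda>i\<in>I. madd (M i) (x i) (y i)),
      ract = (\<lambda>x r. \<lambda>i\<in>I. ract (M i) (x i) r),
      component = (\<lambda>\<gamma>. \<Pi>\<^sub>E i\<in>I. component (M i) \<gamma>)\<rparr>"

definition graded_hom ::
    "('a, 'c) ring_scheme \<Rightarrow> ('b, 'a, 'g) graded_right_module \<Rightarrow> ('d, 'a, 'g) graded_right_module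
      \<Rightarrow> ('b \<Rightarrow> 'd) set" where
  "graded_hom R M N =
     {f \<in> carrier M \<rightarrow> carrier N.
        (\<forall>x\<in>carrier M. \<forall>y\<in>carrier M. f (madd M x y) = madd N (f x) (f y)) \<and>
        (\<forall>x\<in>carrier M. \<forall>r\<in>carrier R. f (ract M x r) = ract N (f x) r) \<and>
        (\<forall>\<gamma>. f ` component M \<gamma> \<subseteq> component N \<gamma>)}"

definition graded_isomorphic ::
    "('a, 'c) ring_scheme \<Rightarrow> ('b, 'a, 'g) graded_right_module \<Rightarrow> ('d, 'a, 'g) graded_right_module
      \<Rightarrow> bool" where
  "graded_isomorphic R M N \<longleftrightarrow> (\<exists>f\<in>graded_hom R M N. bij_betw f (carrier M) (carrier N))"

definition gr_IBN :: "('a, 'c) ring_scheme \<Rightarrow> ('g::ab_group_add \<Rightarrow> 'a set) \<Rightarrow> bool" where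
  "gr_IBN R gr \<longleftrightarrow>
     (\<forall>(m::nat) (n::nat) (\<alpha> :: nat \<Rightarrow> 'g) (\<beta> :: nat \<Rightarrow> 'g). 0 < m \<longrightarrow> 0 < n \<longrightarrow>
        graded_isomorphic R
          (direct_sum {1..m} (\<lambda>i. graded_shift (regular_module R gr) (\<alpha> i)))
          (direct_sum {1..n} (\<lambda>j. graded_shift (regular_module R gr) (\<beta> j)))
        \<longrightarrow> m = n)"

section \<open>Free associative algebras\<close>

text \<open>
  Words form a free monoid, written additively because the convolution product of
  \<^type>\<open>poly_mapping\<close> is indexed by an additive (here non-commutative) monoid. Hence
  \<open>'x word \<Rightarrow>\<^sub>0 'k\<close> is the free unital associative \<open>'k\<close>-algebra on \<open>'x\<close>.
\<close>

datatype 'x word = Word (letters: "'x list")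

instantiation word :: (type) monoid_add
begin

definition zero_word :: "'a word" where "0 = Word []"

definition plus_word :: "'a word \<Rightarrow> 'a word \<Rightarrow> 'a word" where
  "u + v = Word (letters u @ letters v)"

instance by standard (simp_all add: zero_word_def plus_word_def)

end

definition gen :: "'x \<Rightarrow> ('x word \<Rightarrow>\<^sub>0 'k::field)" where
  "gen x = Poly_Mapping.single (Word [x]) 1"

definition free_algebra :: "'k::field itself \<Rightarrow> 'x set \<Rightarrow> ('x word \<Rightarrow>\<^sub>0 'k) ring" where
  "free_algebra _ X =
     \<lparr>carrier = {p. \<forall>w\<in>Poly_Mapping.keys p. set (letters w) \<subseteq> X},
      monoid.mult = (*), one = 1, zero = 0, add = (+)\<rparr>"

text \<open>
  \<^const>\<open>genideal\<close> intersects all sets satisfying \<^const>\<open>ideal\<close>, which in turn demands a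
  (unital) ring; the following lemma makes sure that this is the intended ideal below.
\<close>

lemma ring_free_algebra: "ring (free_algebra TYPE('k::field) X)"
proof -
  have plus: "set (letters w) \<subseteq> X" if "w \<in> Poly_Mapping.keys (p + q)"
    "\<forall>w\<in>Poly_Mapping.keys p. set (letters w) \<subseteq> X" "\<forall>w\<in>Poly_Mapping.keys q. set (letters w) \<subseteq> X"
    for p q :: "'a word \<Rightarrow>\<^sub>0 'k" and w
    using that Poly_Mapping.keys_add[of p q] by blast
  have times: "set (letters w) \<subseteq> X" if "w \<in> Poly_Mapping.keys (p * q)"
    "\<forall>w\<in>Poly_Mapping.keys p. set (letters w) \<subseteq> X" "\<forall>w\<in>Poly_Mapping.keys q. set (letters w) \<subseteq> X"
    for p q :: "'a word \<Rightarrow>\<^sub>0 'k" and w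
  proof -
    have "w \<in> {u + v |u v. u \<in> Poly_Mapping.keys p \<and> v \<in> Poly_Mapping.keys q}"
      using that(1) Poly_Mapping.keys_mult[of p q] by blast
    then show ?thesis using that(2,3) by (fastforce simp: plus_word_def)
  qed
  show ?thesis
  proof (intro ringI abelian_groupI monoidI)
    fix p assume "p \<in> carrier (free_algebra TYPE('k) X)"
    then show "\<exists>q\<in>carrier (free_algebra TYPE('k) X).
        q \<oplus>\<^bsub>free_algebra TYPE('k) X\<^esub> p = \<zero>\<^bsub>free_algebra TYPE('k) X\<^esub>"
      by (intro bexI[of _ "- p"]) (auto simp: free_algebra_def)
  qed (auto simp: free_algebra_def algebra_simps zero_word_def dest: plus times)
qed

section \<open>Leavitt path algebras\<close>

datatype ('v, 'e) lpa_gen = Vertex 'v | Edge 'e | Ghost 'e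

definition lpa_gens :: "('v, 'e) pre_digraph \<Rightarrow> ('v, 'e) lpa_gen set" where
  "lpa_gens E = Vertex ` verts E \<union> Edge ` arcs E \<union> Ghost ` arcs E"

abbreviation lpa_free ::
    "'k::field itself \<Rightarrow> ('v, 'e) pre_digraph \<Rightarrow> (('v, 'e) lpa_gen word \<Rightarrow>\<^sub>0 'k) ring" where
  "lpa_free K E \<equiv> free_algebra K (lpa_gens E)"

definition sink :: "('v, 'e) pre_digraph \<Rightarrow> 'v \<Rightarrow> bool" where
  "sink E v \<longleftrightarrow> v \<in> verts E \<and> out_arcs E v = {}"

definition regular_vertex :: "('v, 'e) pre_digraph \<Rightarrow> 'v \<Rightarrow> bool" where
  "regular_vertex E v \<longleftrightarrow> v \<in> verts E \<and> out_arcs E v \<noteq> {} \<and> finite (out_arcs E v)"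

definition lpa_relations ::
    "'k::field itself \<Rightarrow> ('v, 'e) pre_digraph \<Rightarrow> (('v, 'e) lpa_gen word \<Rightarrow>\<^sub>0 'k) set" where
  "lpa_relations _ E =
     {gen (Vertex v) * gen (Vertex w) - (if v = w then gen (Vertex w) else 0) | v w.
        v \<in> verts E \<and> w \<in> verts E}
   \<union> {gen (Vertex (tail E e)) * gen (Edge e) - gen (Edge e) | e. e \<in> arcs E}
   \<union> {gen (Edge e) * gen (Vertex (head E e)) - gen (Edge e) | e. e \<in> arcs E}
   \<union> {gen (Vertex (head E e)) * gen (Ghost e) - gen (Ghost e) | e. e \<in> arcs E}
   \<union> {gen (Ghost e) * gen (Vertex (tail E e)) - gen (Ghost e) | e. e \<in> arcs E}
   \<union> {gen (Ghost e) * gen (Edge f) - (if e = f then gen (Vertex (head E e)) else 0) | e f.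
        e \<in> arcs E \<and> f \<in> arcs E}
   \<union> {gen (Vertex v) - (\<Sum>e\<in>out_arcs E v. gen (Edge e) * gen (Ghost e)) | v.
        regular_vertex E v}"

definition lpa_ideal ::
    "'k::field itself \<Rightarrow> ('v, 'e) pre_digraph \<Rightarrow> (('v, 'e) lpa_gen word \<Rightarrow>\<^sub>0 'k) set" where
  "lpa_ideal K E = Idl\<^bsub>lpa_free K E\<^esub> (lpa_relations K E)"

text \<open>
  The presentation of a Leavitt path algebra is one of not necessarily unital algebras: in the
  unital free algebra modulo the relations, \<open>1 - (\<Sum>v\<in>verts E. v)\<close> would survive as a spurious
  idempotent. So \<open>L_K(E)\<close> consists of the classes of the combinations of nonempty
  words. Its identity element, which exists if there are finitely many vertices, is the
  sum of the vertices. (The ideal generated in the unital free algebra lies in the nonunital one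
  and coincides with the algebra ideal generated there.)
\<close>

definition lpa_free_nonunital ::
    "'k::field itself \<Rightarrow> ('v, 'e) pre_digraph \<Rightarrow> (('v, 'e) lpa_gen word \<Rightarrow>\<^sub>0 'k) set" where
  "lpa_free_nonunital K E = {p \<in> carrier (lpa_free K E). 0 \<notin> Poly_Mapping.keys p}"

definition leavitt_path_algebra ::
    "'k::field itself \<Rightarrow> ('v, 'e) pre_digraph \<Rightarrow> (('v, 'e) lpa_gen word \<Rightarrow>\<^sub>0 'k) set ring" where
  "leavitt_path_algebra K E =
     (lpa_free K E Quot lpa_ideal K E)
       \<lparr>carrier := (\<lambda>p. lpa_ideal K E +>\<^bsub>lpa_free K E\<^esub> p) ` lpa_free_nonunital K E,
        one := lpa_ideal K E +>\<^bsub>lpa_free K E\<^esub> (\<Sum>v\<in>verts E. gen (Vertex v))\<rparr>"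

fun gen_degree :: "('v, 'e) lpa_gen \<Rightarrow> int" where
  "gen_degree (Vertex v) = 0"
| "gen_degree (Edge e) = 1"
| "gen_degree (Ghost e) = -1"

definition word_degree :: "('v, 'e) lpa_gen word \<Rightarrow> int" where
  "word_degree w = (\<Sum>x\<leftarrow>letters w. gen_degree x)"

definition lpa_grading ::
    "'k::field itself \<Rightarrow> ('v, 'e) pre_digraph \<Rightarrow> int \<Rightarrow> (('v, 'e) lpa_gen word \<Rightarrow>\<^sub>0 'k) set set" where
  "lpa_grading K E d =
     (\<lambda>p. lpa_ideal K E +>\<^bsub>lpa_free K E\<^esub> p) `
       {p \<in> lpa_free_nonunital K E. \<forall>w\<in>Poly_Mapping.keys p. word_degree w = d}"

section \<open>Adjacency matrices\<close>

text \<open>The list \<open>vs\<close> is the enumeration of the vertices indexing rows and columns.\<close>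

definition adjacency_matrix :: "('v, 'e) pre_digraph \<Rightarrow> 'v list \<Rightarrow> int mat" where
  "adjacency_matrix E vs =
     mat (length vs) (length vs)
       (\<lambda>(i, j). int (card {e \<in> arcs E. tail E e = vs ! i \<and> head E e = vs ! j}))"

definition ones_row :: "nat \<Rightarrow> int mat" where
  "ones_row h = mat 1 h (\<lambda>_. 1)"

definition power_sum_mat :: "int mat \<Rightarrow> nat \<Rightarrow> (nat \<Rightarrow> nat) \<Rightarrow> int mat" where
  "power_sum_mat A m p =
     (\<Oplus>\<^bsub>ring_mat TYPE(int) (dim_row A) ()\<^esub> i\<in>{1..m}. A ^\<^sub>m p i)"

end

theory Submission
  imports Defs "Graph_Theory.Arc_Walk" "Jordan_Normal_Form.Determinant"
begin

text \<open>
  Write \<open>L\<close> for the Leavitt path algebra. The entry at \<open>w\<close> of the all-ones row times \<open>A\<^sup>p\<close> is the number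
  of walks of length \<open>p\<close> ending at \<open>w\<close> (\<open>ones_row_power_sum_counts_walks\<close>). Hence the matrix equation says
  that the walks of lengths \<open>p\<^sub>1, \<dots>, p\<^sub>m\<close> and the walks of lengths \<open>q\<^sub>1, \<dots>, q\<^sub>n\<close>, counted with
  repetition, are equally many for each end. On the other hand, a graded
  isomorphism between shifted free modules is a pair of mutually inverse matrices over \<open>L\<close>, the
  first with homogeneous entries of degrees \<open>\<beta>\<^sub>j - \<alpha>\<^sub>i\<close>.

  If the counts agree, the walks of the first kind can be matched with those of the second kind so
  that ends are preserved. Since there are no sinks, \<open>1 = \<Sum> \<mu> \<mu>\<^sup>*\<close> over the walks of any fixed length,
  and \<open>\<mu>\<^sup>* \<mu>'\<close> is \<open>0\<close> or a vertex for walks of that length. So the sums of \<open>\<nu> \<mu>\<^sup>*\<close> over matched pairs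
  \<open>(\<mu>, \<nu>)\<close> are the entries of a matrix whose inverse has the entries \<open>\<mu> \<nu>\<^sup>*\<close>
  (\<open>equal_walk_counts_imp_graded_isomorphic\<close>).

  For the converse, the dimensions of spaces spanned by walks serve as an invariant. The free algebra
  acts on walks:
  an edge is prepended, a ghost edge is cancelled. Walks of length zero violate the relation
  \<open>v = \<Sum> e e\<^sup>*\<close>, so this is not an action of \<open>L\<close>; but each element of the ideal of relations acts as
  zero on all sufficiently long walks (\<open>lpa_ideal_vanishes_on_long_walks\<close>). Mutually inverse matrices over
  \<open>L\<close> involve finitely many elements, hence for large \<open>k\<close> they act as mutually inverse matrices over
  the field between the spaces spanned by the walks of lengths \<open>k + \<alpha>\<^sub>i\<close> and of lengths \<open>k + \<beta>\<^sub>j\<close>. The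
  action keeps the end of a walk, so there are equally many walks on both sides for each end
  (\<open>graded_isomorphic_imp_equal_walk_counts\<close>), and \<open>k + \<alpha>\<^sub>i\<close>, \<open>k + \<beta>\<^sub>j\<close> are the required exponents.
\<close>

section \<open>Counting walks by powers of the adjacency matrix\<close>

lemma finsum_ring_mat:
  assumes "finite S" "\<And>i. i \<in> S \<Longrightarrow> M i \<in> carrier_mat h h"
  shows "(\<Oplus>\<^bsub>ring_mat TYPE('a::comm_ring_1) h ()\<^esub> i\<in>S. M i) = mat h h (\<lambda>(r, c). \<Sum>i\<in>S. M i $$ (r, c))"
  using assms
proof (induction S rule: finite_induct)
  interpret ring "ring_mat TYPE('a) h ()" by (rule ring_mat)
  case empty
  show ?case by (auto simp: ring_mat_simps)
next
  interpret ring "ring_mat TYPE('a) h ()" by (rule ring_mat)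
  case (insert x S)
  have "(\<Oplus>\<^bsub>ring_mat TYPE('a) h ()\<^esub> i\<in>insert x S. M i)
      = M x + (\<Oplus>\<^bsub>ring_mat TYPE('a) h ()\<^esub> i\<in>S. M i)"
    using insert by (subst finsum_insert) (auto simp: ring_mat_simps)
  then show ?case using insert by (auto intro!: eq_matI)
qed

context fin_digraph
begin

text \<open>
  A walk is stored as its source together with its list of arcs, so that walks of length zero at
  different vertices remain different.
\<close>

definition walks_into :: "'a \<Rightarrow> nat \<Rightarrow> ('a \<times> 'b list) set" where
  "walks_into w k = {(u, es). awalk u es w \<and> length es = k}"

lemma finite_walks_into: "finite (walks_into w k)"
proof (rule finite_subset)
  show "walks_into w k \<subseteq> verts G \<times> {es. set es \<subseteq> arcs G \<and> length es = k}"
    by (auto simp: walks_into_def awalk_def)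
qed (intro finite_SigmaI finite_verts finite_lists_length_eq finite_arcs)

lemma card_walks_eq_sum_out_arcs:
  assumes "u \<in> verts G"
  shows "card {es. awalk u es w \<and> length es = Suc k}
       = (\<Sum>e\<in>out_arcs G u. card {es. awalk (head G e) es w \<and> length es = k})"
proof -
  let ?W = "\<lambda>x. {es. awalk x es w \<and> length es = k}"
  have fin: "finite (?W x)" for x
    by (rule finite_subset[OF _ finite_lists_length_eq[of "arcs G" k]]) (auto simp: awalk_def)
  have "{es. awalk u es w \<and> length es = Suc k}
      = (\<lambda>(e, es). e # es) ` (SIGMA e:out_arcs G u. ?W (head G e))"
    by (auto simp: length_Suc_conv awalk_Cons_iff image_iff)
  also have "card \<dots> = card (SIGMA e:out_arcs G u. ?W (head G e))"
    by (rule card_image) (auto simp: inj_on_def)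
  also have "\<dots> = (\<Sum>e\<in>out_arcs G u. card (?W (head G e)))"
    using fin by (subst card_SigmaI) auto
  finally show ?thesis .
qed

text \<open>
  This regroups the arcs leaving \<open>u\<close> by their head, turning a sum over arcs into a row of the
  adjacency matrix times a vector.
\<close>

lemma sum_out_arcs_by_head:
  fixes f :: "'a \<Rightarrow> int"
  assumes "distinct vs" "set vs = verts G"
  shows "(\<Sum>e\<in>out_arcs G u. f (head G e))
       = (\<Sum>j<length vs. int (card {e \<in> arcs G. tail G e = u \<and> head G e = vs ! j}) * f (vs ! j))"
proof -
  have "(\<Sum>e\<in>out_arcs G u. f (head G e))
      = (\<Sum>v\<in>verts G. \<Sum>e\<in>{e \<in> out_arcs G u. head G e = v}. f (head G e))"
    by (rule sum.group[symmetric]) auto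
  also have "\<dots> = (\<Sum>v\<in>verts G. int (card {e \<in> arcs G. tail G e = u \<and> head G e = v}) * f v)"
    by (rule sum.cong) (auto simp: out_arcs_def)
  also have "\<dots> = (\<Sum>j<length vs. int (card {e \<in> arcs G. tail G e = u \<and> head G e = vs ! j}) * f (vs ! j))"
    using bij_betw_nth[OF assms(1) refl assms(2)[symmetric]] by (rule sum.reindex_bij_betw[symmetric])
  finally show ?thesis .
qed

lemma adjacency_power_counts_walks:
  assumes vs: "distinct vs" "set vs = verts G" and ij: "i < length vs" "j < length vs"
  shows "(adjacency_matrix G vs ^\<^sub>m k) $$ (i, j) = int (card {es. awalk (vs ! i) es (vs ! j) \<and> length es = k})"
  using ij(1)
proof (induction k arbitrary: i)
  case 0
  have "{es. awalk (vs ! i) es (vs ! j) \<and> length es = 0} = (if i = j then {[]} else {})"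
    using vs ij 0 by (auto simp: awalk_Nil_iff nth_eq_iff_index_eq)
  then show ?case using 0 ij by (auto simp: adjacency_matrix_def)
next
  case (Suc k)
  let ?A = "adjacency_matrix G vs" and ?h = "length vs"
  have A: "?A \<in> carrier_mat ?h ?h" by (simp add: adjacency_matrix_def)
  have "?A ^\<^sub>m Suc k = ?A * ?A ^\<^sub>m k"
    using semiring.semiring_simprules monoid.nat_pow_Suc2
    by (metis A pow_mat_ring_pow[OF A] ring_mat_simps(1,5) ring.is_monoid ring_mat)
  then have "(?A ^\<^sub>m Suc k) $$ (i, j) = (\<Sum>l<?h. ?A $$ (i, l) * (?A ^\<^sub>m k) $$ (l, j))"
    using A Suc.prems ij by (simp add: scalar_prod_def lessThan_atLeast0)
  also have "\<dots> = (\<Sum>l<?h. int (card {e \<in> arcs G. tail G e = vs ! i \<and> head G e = vs ! l})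
      * int (card {es. awalk (vs ! l) es (vs ! j) \<and> length es = k}))"
    using Suc by (intro sum.cong) (auto simp: adjacency_matrix_def)
  also have "\<dots> = (\<Sum>e\<in>out_arcs G (vs ! i). int (card {es. awalk (head G e) es (vs ! j) \<and> length es = k}))"
    using sum_out_arcs_by_head[OF vs, of "\<lambda>v. int (card {es. awalk v es (vs ! j) \<and> length es = k})"] by simp
  also have "\<dots> = int (card {es. awalk (vs ! i) es (vs ! j) \<and> length es = Suc k})"
    using Suc.prems vs by (subst card_walks_eq_sum_out_arcs) (auto simp flip: vs(2))
  finally show ?case .
qed

text \<open>
  The all-ones row adds up the walks over all sources, so that an entry of the row only remembers where
  the walks end.
\<close>

lemma ones_row_power_sum_counts_walks:
  assumes vs: "distinct vs" "set vs = verts G" and l: "l < length vs"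
  shows "(ones_row (length vs) * power_sum_mat (adjacency_matrix G vs) m p) $$ (0, l)
       = (\<Sum>i\<in>{1..m}. int (card (walks_into (vs ! l) (p i))))"
proof -
  let ?A = "adjacency_matrix G vs" and ?h = "length vs"
  have A: "?A \<in> carrier_mat ?h ?h" by (simp add: adjacency_matrix_def)
  have S: "power_sum_mat ?A m p = mat ?h ?h (\<lambda>(r, c). \<Sum>i\<in>{1..m}. (?A ^\<^sub>m p i) $$ (r, c))"
    unfolding power_sum_mat_def using A by (subst finsum_ring_mat) auto
  have "(ones_row ?h * power_sum_mat ?A m p) $$ (0, l)
      = (\<Sum>r<?h. \<Sum>i\<in>{1..m}. (?A ^\<^sub>m p i) $$ (r, l))"
    using l by (simp add: S ones_row_def scalar_prod_def lessThan_atLeast0)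
  also have "\<dots> = (\<Sum>i\<in>{1..m}. \<Sum>r<?h. (?A ^\<^sub>m p i) $$ (r, l))" by (rule sum.swap)
  also have "\<dots> = (\<Sum>i\<in>{1..m}. int (card (walks_into (vs ! l) (p i))))"
  proof (rule sum.cong[OF refl])
    fix i
    let ?W = "\<lambda>u. {es. awalk u es (vs ! l) \<and> length es = p i}"
    have fin: "finite (?W u)" for u
      by (rule finite_subset[OF _ finite_lists_length_eq[of "arcs G" "p i"]]) (auto simp: awalk_def)
    have "walks_into (vs ! l) (p i) = (SIGMA u:verts G. ?W u)"
      by (auto simp: walks_into_def awalk_def)
    then have "int (card (walks_into (vs ! l) (p i))) = (\<Sum>u\<in>verts G. int (card (?W u)))"
      using fin by (simp add: card_SigmaI)
    also have "\<dots> = (\<Sum>r<?h. int (card (?W (vs ! r))))"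
      using bij_betw_nth[OF vs(1) refl vs(2)[symmetric]] by (rule sum.reindex_bij_betw[symmetric])
    also have "\<dots> = (\<Sum>r<?h. (?A ^\<^sub>m p i) $$ (r, l))"
      using l by (simp add: adjacency_power_counts_walks[OF vs])
    finally show "(\<Sum>r<?h. (?A ^\<^sub>m p i) $$ (r, l)) = int (card (walks_into (vs ! l) (p i)))" by simp
  qed
  finally show ?thesis .
qed

lemma ones_row_power_sum_eq_iff:
  assumes vs: "distinct vs" "set vs = verts G"
  shows "ones_row (length vs) * power_sum_mat (adjacency_matrix G vs) m p =
       ones_row (length vs) * power_sum_mat (adjacency_matrix G vs) n q \<longleftrightarrow>
    (\<forall>w\<in>verts G. (\<Sum>i\<in>{1..m}. card (walks_into w (p i))) = (\<Sum>j\<in>{1..n}. card (walks_into w (q j))))"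
    (is "?X m p = ?X n q \<longleftrightarrow> ?R")
proof -
  have A: "adjacency_matrix G vs \<in> carrier_mat (length vs) (length vs)" by (simp add: adjacency_matrix_def)
  have dim: "?X a b \<in> carrier_mat 1 (length vs)" for a b
    unfolding power_sum_mat_def using A by (auto simp: finsum_ring_mat ones_row_def)
  have row_eq: "M = M' \<longleftrightarrow> (\<forall>l<h. M $$ (0, l) = M' $$ (0, l))"
    if "M \<in> carrier_mat 1 h" "M' \<in> carrier_mat 1 h" for M M' :: "int mat" and h
    using that by (auto intro!: eq_matI)
  have "?X m p = ?X n q \<longleftrightarrow> (\<forall>l<length vs. ?X m p $$ (0, l) = ?X n q $$ (0, l))"
    by (rule row_eq[OF dim dim])
  also have "\<dots> \<longleftrightarrow> (\<forall>l<length vs. (\<Sum>i\<in>{1..m}. card (walks_into (vs ! l) (p i)))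
      = (\<Sum>j\<in>{1..n}. card (walks_into (vs ! l) (q j))))"
    by (simp add: ones_row_power_sum_counts_walks[OF vs] flip: of_nat_sum)
  also have "\<dots> \<longleftrightarrow> ?R" by (auto simp flip: vs(2) simp: all_set_conv_all_nth)
  finally show ?thesis .
qed

end

section \<open>Right invertible matrices over a field\<close>

text \<open>
  The trace would only give equality of the two sizes modulo the characteristic of the field. If
  \<open>m < n\<close>, padding both factors with zeros to \<open>n \<times> n\<close> matrices leaves the product unchanged, and a zero column forces
  the determinant of the product to vanish.
\<close>

lemma matrix_right_inverse_rows_le:
  fixes A B :: "'k::field mat"
  assumes A: "A \<in> carrier_mat n m" and B: "B \<in> carrier_mat m n" and AB: "A * B = 1\<^sub>m n"
  shows "n \<le> m"
proof (rule ccontr)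
  assume "\<not> n \<le> m"
  then have mn: "m < n" by simp
  define A' where "A' = mat n n (\<lambda>(i, j). if j < m then A $$ (i, j) else 0)"
  define B' where "B' = mat n n (\<lambda>(i, j). if i < m then B $$ (i, j) else 0)"
  have carr: "A' \<in> carrier_mat n n" "B' \<in> carrier_mat n n" by (auto simp: A'_def B'_def)
  have "A' * B' = A * B"
  proof (rule eq_matI)
    fix i j assume "i < dim_row (A * B)" "j < dim_col (A * B)"
    then have ij: "i < n" "j < n" using A B by auto
    have "(A' * B') $$ (i, j) = (\<Sum>k\<in>{0..<n}. A' $$ (i, k) * B' $$ (k, j))"
      using ij carr by (simp add: scalar_prod_def)
    also have "\<dots> = (\<Sum>k\<in>{0..<m}. A $$ (i, k) * B $$ (k, j))"
      using ij mn by (intro sum.mono_neutral_cong_right) (auto simp: A'_def B'_def)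
    also have "\<dots> = (A * B) $$ (i, j)" using ij A B by (simp add: scalar_prod_def)
    finally show "(A' * B') $$ (i, j) = (A * B) $$ (i, j)" .
  qed (use A B carr in auto)
  then have "det A' * det B' = 1" using AB det_mult[OF carr] by simp
  moreover have "det A' = 0"
  proof -
    have "(\<Prod>j<n. A' $$ (p j, j)) = 0" if "p permutes {0..<n}" for p
    proof (rule prod_zero)
      have "p m < n" using that mn permutes_in_image[OF that, of m] by simp
      then show "\<exists>j\<in>{..<n}. A' $$ (p j, j) = 0" using mn by (intro bexI[of _ m]) (auto simp: A'_def)
    qed simp
    then show ?thesis unfolding det_col[OF carr(1)] by (intro sum.neutral) simp
  qed
  ultimately show False by simp
qed

lemma right_invertible_family_card_le:
  fixes a :: "'x \<Rightarrow> 'y \<Rightarrow> 'k::field"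
  assumes fin: "finite P" "finite Q"
    and inv: "\<And>x x'. x \<in> P \<Longrightarrow> x' \<in> P \<Longrightarrow> (\<Sum>y\<in>Q. a x y * b y x') = (if x = x' then 1 else 0)"
  shows "card P \<le> card Q"
proof -
  obtain f where f: "bij_betw f {0..<card P} P" using fin(1) ex_bij_betw_nat_finite by blast
  obtain g where g: "bij_betw g {0..<card Q} Q" using fin(2) ex_bij_betw_nat_finite by blast
  show ?thesis
  proof (rule matrix_right_inverse_rows_le)
    show "mat (card P) (card Q) (\<lambda>(i, j). a (f i) (g j)) * mat (card Q) (card P) (\<lambda>(i, j). b (g i) (f j))
      = 1\<^sub>m (card P)"
    proof (rule eq_matI)
      fix i j assume "i < dim_row (1\<^sub>m (card P) :: 'k mat)" "j < dim_col (1\<^sub>m (card P) :: 'k mat)"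
      then have ij: "i \<in> {0..<card P}" "j \<in> {0..<card P}" by auto
      have "(\<Sum>k\<in>{0..<card Q}. a (f i) (g k) * b (g k) (f j)) = (\<Sum>y\<in>Q. a (f i) y * b y (f j))"
        by (rule sum.reindex_bij_betw[OF g])
      also have "\<dots> = (if f i = f j then 1 else 0)"
        using ij f by (intro inv) (auto simp: bij_betw_def)
      also have "\<dots> = (if i = j then 1 else 0)"
        using ij f by (auto simp: bij_betw_def inj_on_eq_iff)
      finally show "(mat (card P) (card Q) (\<lambda>(i, j). a (f i) (g j)) * mat (card Q) (card P) (\<lambda>(i, j). b (g i) (f j))) $$ (i, j)
        = 1\<^sub>m (card P) $$ (i, j)" using ij by (simp add: scalar_prod_def)
    qed auto
  qed auto
qed

section \<open>Linear functionals on free algebras\<close>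

abbreviation (input) coeff :: "('x word \<Rightarrow>\<^sub>0 'k::field) \<Rightarrow> 'x word \<Rightarrow> 'k" where
  "coeff \<equiv> Poly_Mapping.lookup"

text \<open>
  The words form a basis of the free algebra, so a function on words is the same as a linear
  functional.
\<close>

definition lin_ext :: "('x word \<Rightarrow> 'k::field) \<Rightarrow> ('x word \<Rightarrow>\<^sub>0 'k) \<Rightarrow> 'k" where
  "lin_ext h p = (\<Sum>w\<in>Poly_Mapping.keys p. coeff p w * h w)"

lemma lin_ext_superset:
  assumes "finite A" "Poly_Mapping.keys p \<subseteq> A"
  shows "lin_ext h p = (\<Sum>w\<in>A. coeff p w * h w)"
  unfolding lin_ext_def using assms by (intro sum.mono_neutral_left) (auto simp: in_keys_iff)

lemma lin_ext_zero [simp]: "lin_ext h 0 = 0"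
  by (simp add: lin_ext_def)

lemma lin_ext_zero_fun [simp]: "lin_ext (\<lambda>w. 0) p = 0"
  by (simp add: lin_ext_def)

lemma lin_ext_single [simp]: "lin_ext h (Poly_Mapping.single w c) = c * h w"
  by (cases "c = 0") (simp_all add: lin_ext_def)

lemma lin_ext_add: "lin_ext h (p + q) = lin_ext h p + lin_ext h q"
proof -
  let ?A = "Poly_Mapping.keys p \<union> Poly_Mapping.keys q"
  have "lin_ext h (p + q) = (\<Sum>w\<in>?A. coeff (p + q) w * h w)"
    by (rule lin_ext_superset) (auto dest: subsetD[OF Poly_Mapping.keys_add])
  also have "\<dots> = (\<Sum>w\<in>?A. coeff p w * h w) + (\<Sum>w\<in>?A. coeff q w * h w)"
    by (simp add: lookup_add algebra_simps sum.distrib)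
  finally show ?thesis by (simp flip: lin_ext_superset)
qed

lemma lin_ext_uminus: "lin_ext h (- p) = - lin_ext h p"
  using lin_ext_add[of h p "- p"] by (simp add: eq_neg_iff_add_eq_0 add.commute)

lemma lin_ext_diff: "lin_ext h (p - q) = lin_ext h p - lin_ext h q"
  using lin_ext_add[of h p "- q"] by (simp add: lin_ext_uminus)

lemma lin_ext_sum: "lin_ext h (sum f A) = (\<Sum>a\<in>A. lin_ext h (f a))"
  by (induction A rule: infinite_finite_induct) (simp_all add: lin_ext_add)

lemma lin_ext_cong:
  "(\<And>w. w \<in> Poly_Mapping.keys p \<Longrightarrow> h w = h' w) \<Longrightarrow> lin_ext h p = lin_ext h' p"
  by (simp add: lin_ext_def)

lemma lin_ext_sum_fun: "lin_ext (\<lambda>w. \<Sum>a\<in>A. f a w) p = (\<Sum>a\<in>A. lin_ext (f a) p)"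
  unfolding lin_ext_def sum_distrib_left by (rule sum.swap)

lemma lin_ext_scale_fun: "lin_ext (\<lambda>w. c * f w) p = c * lin_ext f p"
  unfolding lin_ext_def sum_distrib_left by (simp add: mult_ac)

lemma poly_mapping_eq_sum_single:
  "p = (\<Sum>w\<in>Poly_Mapping.keys p. Poly_Mapping.single w (coeff p w))"
proof (rule poly_mapping_eqI)
  fix v
  show "coeff p v = coeff (\<Sum>w\<in>Poly_Mapping.keys p. Poly_Mapping.single w (coeff p w)) v"
    by (auto simp: lookup_sum lookup_single when_def in_keys_iff)
qed

text \<open>
  The words of \<open>q\<close> are summed outside because they act first on a walk when \<open>p * q\<close> is applied
  to it.
\<close>

lemma lin_ext_mult: "lin_ext h (p * q) = lin_ext (\<lambda>v. lin_ext (\<lambda>u. h (u + v)) p) q"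
proof -
  let ?s = "\<lambda>p w. Poly_Mapping.single w (coeff p w)"
  have "p * q = (\<Sum>u\<in>Poly_Mapping.keys p. ?s p u) * (\<Sum>v\<in>Poly_Mapping.keys q. ?s q v)"
    by (rule arg_cong2[where f = "(*)"]; rule poly_mapping_eq_sum_single)
  also have "\<dots> = (\<Sum>v\<in>Poly_Mapping.keys q. \<Sum>u\<in>Poly_Mapping.keys p. ?s p u * ?s q v)"
    unfolding sum_product by (rule sum.swap)
  finally have "lin_ext h (p * q) = (\<Sum>v\<in>Poly_Mapping.keys q. \<Sum>u\<in>Poly_Mapping.keys p.
      coeff p u * coeff q v * h (u + v))"
    by (simp add: lin_ext_sum mult_single)
  also have "\<dots> = lin_ext (\<lambda>v. lin_ext (\<lambda>u. h (u + v)) p) q"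
    by (simp add: lin_ext_def sum_distrib_left mult_ac)
  finally show ?thesis .
qed

lemma lin_ext_gen [simp]: "lin_ext h (gen x) = h (Word [x])"
  by (simp add: gen_def)

lemma gen_mult_gen: "gen x * gen y = Poly_Mapping.single (Word [x, y]) 1"
  by (simp add: gen_def mult_single plus_word_def)

lemma lin_ext_gen_mult_gen [simp]: "lin_ext h (gen x * gen y) = h (Word [x, y])"
  by (simp add: gen_mult_gen)

section \<open>The action of the free algebra on walks\<close>

context wf_digraph
begin

text \<open>
  Letters act on walks from the left: \<open>Edge e\<close> prepends \<open>e\<close>, \<open>Ghost e\<close> removes a leading \<open>e\<close>, and
  \<open>Vertex v\<close> tests the source. The value \<open>None\<close> stands for zero. The defining relations hold under this
  action, except that \<open>\<Sum> e e\<^sup>*\<close> kills the walks of length zero.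
\<close>

fun act_letter :: "('a, 'b) lpa_gen \<Rightarrow> 'a \<times> 'b list \<Rightarrow> ('a \<times> 'b list) option" where
  "act_letter (Vertex v) (u, es) = (if u = v then Some (u, es) else None)"
| "act_letter (Edge e) (u, es) = (if head G e = u then Some (tail G e, e # es) else None)"
| "act_letter (Ghost e) (u, []) = None"
| "act_letter (Ghost e) (u, f # es) = (if e = f then Some (head G e, es) else None)"

fun act_letters :: "('a, 'b) lpa_gen list \<Rightarrow> 'a \<times> 'b list \<Rightarrow> ('a \<times> 'b list) option" where
  "act_letters [] \<mu> = Some \<mu>"
| "act_letters (x # xs) \<mu> = Option.bind (act_letters xs \<mu>) (act_letter x)"

definition act :: "('a, 'b) lpa_gen word \<Rightarrow> 'a \<times> 'b list \<Rightarrow> ('a \<times> 'b list) option" where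
  "act w = act_letters (letters w)"

lemma act_letters_append: "act_letters (xs @ ys) \<mu> = Option.bind (act_letters ys \<mu>) (act_letters xs)"
  by (induction xs) (auto split: bind_splits)

lemma act_add: "act (u + v) \<mu> = Option.bind (act v \<mu>) (act u)"
  by (simp add: act_def plus_word_def act_letters_append)

lemma act_letter_degree:
  assumes "act_letter x (u, es) = Some (u', es')" "x \<in> lpa_gens G" "awalk u es w"
  shows "awalk u' es' w \<and> int (length es') = int (length es) + gen_degree x"
  using assms by (induction x "(u, es)" rule: act_letter.induct)
    (auto simp: lpa_gens_def awalk_Cons_iff split: if_splits)

text \<open>
  The end \<open>w\<close> is unchanged and the length changes by the degree; hence the walks with a fixed end
  and a fixed length are the finitely many basis elements of one homogeneous piece.
\<close>

lemma act_degree: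
  assumes "act a (u, es) = Some (u', es')" "set (letters a) \<subseteq> lpa_gens G" "awalk u es w"
  shows "awalk u' es' w \<and> int (length es') = int (length es) + word_degree a"
proof -
  have "awalk u' es' w \<and> int (length es') = int (length es) + (\<Sum>x\<leftarrow>xs. gen_degree x)"
    if "act_letters xs (u, es) = Some (u', es')" "set xs \<subseteq> lpa_gens G" for xs u' es'
    using that
  proof (induction xs arbitrary: u' es')
    case Nil
    then show ?case using assms(3) by simp
  next
    case (Cons x xs)
    then obtain u1 es1 where 1: "act_letters xs (u, es) = Some (u1, es1)"
      "act_letter x (u1, es1) = Some (u', es')" by (auto split: bind_splits)
    show ?case using Cons.IH[OF 1(1)] act_letter_degree[OF 1(2)] Cons.prems by auto
  qed
  then show ?thesis using assms by (simp add: act_def word_degree_def)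
qed

lemma word_degree_ge: "- int (length (letters a)) \<le> word_degree (a :: ('a, 'b) lpa_gen word)"
proof -
  have "- int (length xs) \<le> (\<Sum>x\<leftarrow>xs. gen_degree x)" for xs :: "('a, 'b) lpa_gen list"
  proof (induction xs)
    case (Cons x xs)
    then show ?case by (cases x) auto
  qed simp
  then show ?thesis by (simp add: word_degree_def)
qed

text \<open>
  The transposed action: it makes the space of all functions on walks a right module over the free
  algebra. Passing to functions avoids formal sums of walks, and \<open>pull \<phi> p \<mu>\<close> for the indicator
  function \<open>\<phi>\<close> of \<open>\<nu>\<close> is the coefficient of \<open>\<nu>\<close> in \<open>p \<mu>\<close>.
\<close>

definition pull :: "('a \<times> 'b list \<Rightarrow> 'k::field) \<Rightarrow> (('a, 'b) lpa_gen word \<Rightarrow>\<^sub>0 'k) \<Rightarrow> 'a \<times> 'b list \<Rightarrow> 'k" where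
  "pull \<phi> p \<mu> = lin_ext (\<lambda>w. case act w \<mu> of None \<Rightarrow> 0 | Some \<nu> \<Rightarrow> \<phi> \<nu>) p"

lemma pull_mult: "pull \<phi> (p * q) = pull (pull \<phi> p) q"
proof
  fix \<mu>
  have "(\<lambda>v. lin_ext (\<lambda>u. case act (u + v) \<mu> of None \<Rightarrow> 0 | Some \<nu> \<Rightarrow> \<phi> \<nu>) p)
      = (\<lambda>v. case act v \<mu> of None \<Rightarrow> 0 | Some \<nu> \<Rightarrow> pull \<phi> p \<nu>)"
    by (rule ext) (simp add: act_add pull_def split: option.split)
  then show "pull \<phi> (p * q) \<mu> = pull (pull \<phi> p) q \<mu>"
    by (simp add: pull_def lin_ext_mult)
qed

lemma pull_zero [simp]: "pull \<phi> 0 \<mu> = 0" 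
  by (simp add: pull_def)

lemma pull_add: "pull \<phi> (p + q) \<mu> = pull \<phi> p \<mu> + pull \<phi> q \<mu>"
  by (simp add: pull_def lin_ext_add)

lemma pull_uminus: "pull \<phi> (- p) \<mu> = - pull \<phi> p \<mu>"
  by (simp add: pull_def lin_ext_uminus)

lemma pull_diff: "pull \<phi> (p - q) \<mu> = pull \<phi> p \<mu> - pull \<phi> q \<mu>"
  by (simp add: pull_def lin_ext_diff)

lemma pull_sum: "pull \<phi> (sum f A) \<mu> = (\<Sum>a\<in>A. pull \<phi> (f a) \<mu>)"
  by (simp add: pull_def lin_ext_sum)

lemma pull_sum_fun: "pull (\<lambda>\<nu>. \<Sum>a\<in>A. c a * f a \<nu>) p \<mu> = (\<Sum>a\<in>A. c a * pull (f a) p \<mu>)"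
proof -
  have "(\<lambda>w. case act w \<mu> of None \<Rightarrow> 0 | Some \<nu> \<Rightarrow> (\<Sum>a\<in>A. c a * f a \<nu>))
     = (\<lambda>w. \<Sum>a\<in>A. c a * (case act w \<mu> of None \<Rightarrow> 0 | Some \<nu> \<Rightarrow> f a \<nu>))"
    by (rule ext) (simp split: option.split)
  then show ?thesis by (simp add: pull_def lin_ext_sum_fun lin_ext_scale_fun)
qed

text \<open>
  Only the walks reached from \<open>(u, es)\<close> by the words of \<open>p\<close> matter, and their ends and lengths are
  known.
\<close>

lemma pull_local:
  assumes p: "p \<in> carrier (free_algebra K (lpa_gens G))" and \<mu>: "awalk u es w"
    and eq: "\<And>u' es' a. a \<in> Poly_Mapping.keys p \<Longrightarrow> awalk u' es' w \<Longrightarrow>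
      int (length es') = int (length es) + word_degree a \<Longrightarrow> \<phi> (u', es') = \<psi> (u', es')"
  shows "pull \<phi> p (u, es) = pull \<psi> p (u, es)"
  unfolding pull_def
proof (rule lin_ext_cong)
  fix a assume a: "a \<in> Poly_Mapping.keys p"
  then have "set (letters a) \<subseteq> lpa_gens G" using p by (auto simp: free_algebra_def)
  with eq[OF a] act_degree[of a u es _ _ w] \<mu>
  show "(case act a (u, es) of None \<Rightarrow> 0 | Some \<nu> \<Rightarrow> \<phi> \<nu>) = (case act a (u, es) of None \<Rightarrow> 0 | Some \<nu> \<Rightarrow> \<psi> \<nu>)"
    by (auto split: option.split)
qed

lemma pull_zero_fun [simp]: "pull (\<lambda>_. 0 :: 'k::field) p \<mu> = 0"
proof -
  have "pull (\<lambda>_. 0 :: 'k) p \<mu> = lin_ext (\<lambda>w. 0) p"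
    unfolding pull_def by (rule lin_ext_cong) (simp split: option.split)
  then show ?thesis by simp
qed

text \<open>
  The elements acting as zero on walks beyond some length. The bound depends on the element: multiplying
  by a word from the right may first shorten a walk, so no fixed bound would give an ideal.
\<close>

definition vanishing_on_long_walks :: "'k::field itself \<Rightarrow> (('a, 'b) lpa_gen word \<Rightarrow>\<^sub>0 'k) set" where
  "vanishing_on_long_walks K = {p \<in> carrier (lpa_free K G).
     \<exists>N. \<forall>\<phi> u es w. awalk u es w \<longrightarrow> N \<le> length es \<longrightarrow> pull \<phi> p (u, es) = 0}"

lemma free_algebra_simps:
  "monoid.mult (free_algebra K X) = (*)" "one (free_algebra K X) = 1"
  "zero (free_algebra K X) = 0" "add (free_algebra K X) = (+)"
  by (simp_all add: free_algebra_def)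

lemma ring_lpa_free: "ring (lpa_free K G)"
  using ring_free_algebra[of "lpa_gens G"] by (simp add: free_algebra_def)

lemma a_inv_lpa_free:
  assumes "p \<in> carrier (lpa_free K G)"
  shows "- p \<in> carrier (lpa_free K G)" "\<ominus>\<^bsub>lpa_free K G\<^esub> p = - p"
proof -
  interpret ring "lpa_free K G" by (rule ring_lpa_free)
  show c: "- p \<in> carrier (lpa_free K G)" using assms by (auto simp: free_algebra_def)
  show "\<ominus>\<^bsub>lpa_free K G\<^esub> p = - p"
    using minus_equality[of "- p" p] assms c by (simp add: free_algebra_simps)
qed

lemma ideal_vanishing_on_long_walks: "ideal (vanishing_on_long_walks K) (lpa_free K G)"
proof -
  interpret ring "lpa_free K G" by (rule ring_lpa_free)
  let ?J = "vanishing_on_long_walks K"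
  show ?thesis
  proof (rule idealI)
    show "subgroup ?J (add_monoid (lpa_free K G))"
    proof (rule add.subgroupI)
      show "?J \<subseteq> carrier (lpa_free K G)" by (auto simp: vanishing_on_long_walks_def)
      show "?J \<noteq> {}"
        using zero_closed by (auto simp: vanishing_on_long_walks_def free_algebra_simps intro!: exI[of _ 0])
    next
      fix p assume "p \<in> ?J"
      then show "\<ominus>\<^bsub>lpa_free K G\<^esub> p \<in> ?J"
        by (auto simp: vanishing_on_long_walks_def a_inv_lpa_free pull_uminus)
    next
      fix p q assume pq: "p \<in> ?J" "q \<in> ?J"
      from pq(1) obtain M where M: "pull \<phi> p (u, es) = 0" if "awalk u es w" "M \<le> length es" for \<phi> u es w
        unfolding vanishing_on_long_walks_def by blast
      from pq(2) obtain N where N: "pull \<phi> q (u, es) = 0" if "awalk u es w" "N \<le> length es" for \<phi> u es w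
        unfolding vanishing_on_long_walks_def by blast
      have "pull \<phi> (p + q) (u, es) = 0" if "awalk u es w" "max M N \<le> length es" for \<phi> u es w
        using M[OF that(1)] N[OF that(1)] that(2) by (simp add: pull_add)
      moreover have "p \<oplus>\<^bsub>lpa_free K G\<^esub> q \<in> carrier (lpa_free K G)"
        using pq by (auto simp: vanishing_on_long_walks_def)
      ultimately show "p \<oplus>\<^bsub>lpa_free K G\<^esub> q \<in> ?J"
        unfolding vanishing_on_long_walks_def free_algebra_simps by blast
    qed
  next
    fix p q assume p: "p \<in> ?J" and q: "q \<in> carrier (lpa_free K G)"
    from p obtain N where N: "pull \<phi> p (u, es) = 0" if "awalk u es w" "N \<le> length es" for \<phi> u es w
      unfolding vanishing_on_long_walks_def by blast
    have pc: "p \<in> carrier (lpa_free K G)" using p by (simp add: vanishing_on_long_walks_def)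
    have "pull \<phi> (q * p) (u, es) = 0" if "awalk u es w" "N \<le> length es" for \<phi> u es w
      using N[OF that] by (simp add: pull_mult)
    moreover have "q \<otimes>\<^bsub>lpa_free K G\<^esub> p \<in> carrier (lpa_free K G)" using pc q by simp
    ultimately show "q \<otimes>\<^bsub>lpa_free K G\<^esub> p \<in> ?J"
      unfolding vanishing_on_long_walks_def free_algebra_simps by blast
    \<comment> \<open>Words of \<open>q\<close> shorten a walk by at most \<open>d\<close>, which leaves a length of at least \<open>N\<close> for \<open>p\<close>.\<close>
    define d where "d = (\<Sum>a\<in>Poly_Mapping.keys q. length (letters a))"
    have "pull \<phi> (p * q) (u, es) = 0" if walk: "awalk u es w" "N + d \<le> length es" for \<phi> u es w
    proof -
      have "pull (pull \<phi> p) q (u, es) = pull (\<lambda>_. 0) q (u, es)"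
      proof (rule pull_local[OF q walk(1)])
        fix u' es' a assume a: "a \<in> Poly_Mapping.keys q" "awalk u' es' w"
          "int (length es') = int (length es) + word_degree a"
        have "length (letters a) \<le> d" unfolding d_def using a(1) by (intro member_le_sum) auto
        then have "N \<le> length es'" using a(3) walk(2) word_degree_ge[of a] by linarith
        then show "pull \<phi> p (u', es') = 0" by (rule N[OF a(2)])
      qed
      then show ?thesis by (simp add: pull_mult)
    qed
    moreover have "p \<otimes>\<^bsub>lpa_free K G\<^esub> q \<in> carrier (lpa_free K G)" using pc q by simp
    ultimately show "p \<otimes>\<^bsub>lpa_free K G\<^esub> q \<in> ?J"
      unfolding vanishing_on_long_walks_def free_algebra_simps by blast
  qed (rule ring_lpa_free)
qed

lemma gen_in_lpa_free:
  "x \<in> lpa_gens G \<Longrightarrow> gen x \<in> carrier (lpa_free K G)"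
  by (auto simp: gen_def free_algebra_def)

lemma lpa_gens_I [simp]:
  "v \<in> verts G \<Longrightarrow> Vertex v \<in> lpa_gens G"
  "e \<in> arcs G \<Longrightarrow> Edge e \<in> lpa_gens G"
  "e \<in> arcs G \<Longrightarrow> Ghost e \<in> lpa_gens G"
  by (auto simp: lpa_gens_def)

lemma lpa_free_closed:
  "0 \<in> carrier (lpa_free K G)"
  "\<lbrakk>p \<in> carrier (lpa_free K G); q \<in> carrier (lpa_free K G)\<rbrakk> \<Longrightarrow> p + q \<in> carrier (lpa_free K G)"
  "\<lbrakk>p \<in> carrier (lpa_free K G); q \<in> carrier (lpa_free K G)\<rbrakk> \<Longrightarrow> p * q \<in> carrier (lpa_free K G)"
  "\<lbrakk>p \<in> carrier (lpa_free K G); q \<in> carrier (lpa_free K G)\<rbrakk> \<Longrightarrow> p - q \<in> carrier (lpa_free K G)"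
proof -
  interpret ring "lpa_free K G" by (rule ring_lpa_free)
  show "0 \<in> carrier (lpa_free K G)" using zero_closed by (simp add: free_algebra_simps)
  show add: "p + q \<in> carrier (lpa_free K G)"
    if "p \<in> carrier (lpa_free K G)" "q \<in> carrier (lpa_free K G)" for p q
    using a_closed[OF that] by (simp add: free_algebra_simps)
  show "p * q \<in> carrier (lpa_free K G)"
    if "p \<in> carrier (lpa_free K G)" "q \<in> carrier (lpa_free K G)" for p q
    using m_closed[OF that] by (simp add: free_algebra_simps)
  show "p - q \<in> carrier (lpa_free K G)"
    if "p \<in> carrier (lpa_free K G)" "q \<in> carrier (lpa_free K G)" for p q
    using add[OF that(1) a_inv_lpa_free(1)[OF that(2)]] by simp
qed

lemma lpa_free_sum_closed:
  "(\<And>a. a \<in> A \<Longrightarrow> f a \<in> carrier (lpa_free K G)) \<Longrightarrow> sum f A \<in> carrier (lpa_free K G)"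
  by (induction A rule: infinite_finite_induct) (auto simp: lpa_free_closed)

lemma lpa_relations_carrier: "lpa_relations K G \<subseteq> carrier (lpa_free K G)"
  unfolding lpa_relations_def
  by (auto intro!: lpa_free_closed lpa_free_sum_closed gen_in_lpa_free simp: regular_vertex_def)

text \<open>
  On a walk with first arc \<open>f\<close>, the only surviving term of \<open>\<Sum> e e\<^sup>*\<close> is \<open>f f\<^sup>*\<close>, which removes \<open>f\<close> and
  puts it back.
\<close>

lemma pull_relation_nonempty_walk:
  assumes "r \<in> lpa_relations K G" and "awalk u (f # es) w"
  shows "pull \<phi> r (u, f # es) = 0"
proof -
  have CK: "pull \<phi> (gen (Vertex v) - (\<Sum>e\<in>out_arcs G v. gen (Edge e) * gen (Ghost e))) (u, f # es) = 0"
    if "regular_vertex G v" for v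
  proof -
    have "(\<Sum>e\<in>out_arcs G v. pull \<phi> (gen (Edge e) * gen (Ghost e)) (u, f # es))
      = (\<Sum>e\<in>out_arcs G v. if e = f then \<phi> (u, f # es) else 0)"
      using assms(2) by (intro sum.cong) (auto simp: pull_def act_def awalk_Cons_iff)
    also have "\<dots> = pull \<phi> (gen (Vertex v)) (u, f # es)"
      using that assms(2) by (auto simp: regular_vertex_def pull_def act_def awalk_Cons_iff)
    finally show ?thesis by (simp add: pull_diff pull_sum)
  qed
  from assms(2) have walk: "f \<in> arcs G" "u = tail G f" "awalk (head G f) es w"
    by (auto simp: awalk_Cons_iff)
  show ?thesis
    using assms(1) unfolding lpa_relations_def
    by (elim UnE CollectE exE conjE)
       (simp_all only: CK, auto simp: walk pull_diff, auto simp: walk pull_def act_def split: list.splits)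
qed

lemma lpa_ideal_vanishes_on_long_walks: "lpa_ideal K G \<subseteq> vanishing_on_long_walks K"
  unfolding lpa_ideal_def
proof (rule ring.genideal_minimal[OF ring_lpa_free ideal_vanishing_on_long_walks], rule subsetI)
  fix r assume r: "r \<in> lpa_relations K G"
  have "pull \<phi> r (u, es) = 0" if "awalk u es w" "1 \<le> length es" for \<phi> u es w
    using pull_relation_nonempty_walk[OF r] that by (cases es) auto
  then show "r \<in> vanishing_on_long_walks K"
    using r lpa_relations_carrier unfolding vanishing_on_long_walks_def by blast
qed

end

section \<open>Calculating with representatives\<close>

context wf_digraph
begin

lemma ideal_lpa_ideal: "ideal (lpa_ideal K G) (lpa_free K G)"
  unfolding lpa_ideal_def by (rule ring.genideal_ideal[OF ring_lpa_free lpa_relations_carrier])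

lemma relation_in_lpa_ideal: "r \<in> lpa_relations K G \<Longrightarrow> r \<in> lpa_ideal K G"
  unfolding lpa_ideal_def using ring.genideal_self[OF ring_lpa_free lpa_relations_carrier] by blast

lemma lpa_ideal_carrier: "r \<in> lpa_ideal K G \<Longrightarrow> r \<in> carrier (lpa_free K G)"
  using ideal.Icarr[OF ideal_lpa_ideal] .

lemma lpa_ideal_closed:
  "0 \<in> lpa_ideal K G"
  "\<lbrakk>p \<in> lpa_ideal K G; q \<in> lpa_ideal K G\<rbrakk> \<Longrightarrow> p + q \<in> lpa_ideal K G"
  "p \<in> lpa_ideal K G \<Longrightarrow> - p \<in> lpa_ideal K G"
  "\<lbrakk>p \<in> lpa_ideal K G; c \<in> carrier (lpa_free K G)\<rbrakk> \<Longrightarrow> c * p \<in> lpa_ideal K G"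
  "\<lbrakk>p \<in> lpa_ideal K G; c \<in> carrier (lpa_free K G)\<rbrakk> \<Longrightarrow> p * c \<in> lpa_ideal K G"
proof -
  interpret ideal "lpa_ideal K G" "lpa_free K G" by (rule ideal_lpa_ideal)
  show "0 \<in> lpa_ideal K G"
    using additive_subgroup.zero_closed[OF is_additive_subgroup] by (simp add: free_algebra_simps)
  show "p + q \<in> lpa_ideal K G" if "p \<in> lpa_ideal K G" "q \<in> lpa_ideal K G"
    using additive_subgroup.a_closed[OF is_additive_subgroup that] by (simp add: free_algebra_simps)
  show "- p \<in> lpa_ideal K G" if "p \<in> lpa_ideal K G"
    using additive_subgroup.a_inv_closed[OF is_additive_subgroup that] a_inv_lpa_free(2)[OF lpa_ideal_carrier[OF that]] by simp
  show "c * p \<in> lpa_ideal K G" if "p \<in> lpa_ideal K G" "c \<in> carrier (lpa_free K G)"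
    using I_l_closed[OF that] by (simp add: free_algebra_simps)
  show "p * c \<in> lpa_ideal K G" if "p \<in> lpa_ideal K G" "c \<in> carrier (lpa_free K G)"
    using I_r_closed[OF that] by (simp add: free_algebra_simps)
qed

text \<open>
  Calculations in the quotient are carried out with representatives in the free algebra, where ring
  operations and finite sums are those of a type.
\<close>

definition lpa_cong ::
  "'k::field itself \<Rightarrow> (('a, 'b) lpa_gen word \<Rightarrow>\<^sub>0 'k) \<Rightarrow> (('a, 'b) lpa_gen word \<Rightarrow>\<^sub>0 'k) \<Rightarrow> bool" where
  "lpa_cong K p q \<longleftrightarrow> p - q \<in> lpa_ideal K G"

lemma lpa_cong_refl [simp]: "lpa_cong K p p"
  by (simp add: lpa_cong_def lpa_ideal_closed)

lemma lpa_cong_sym: "lpa_cong K p q \<Longrightarrow> lpa_cong K q p"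
  unfolding lpa_cong_def using lpa_ideal_closed(3)[of "p - q" K] by simp

lemma lpa_cong_trans [trans]: "lpa_cong K p q \<Longrightarrow> lpa_cong K q r \<Longrightarrow> lpa_cong K p r"
  unfolding lpa_cong_def using lpa_ideal_closed(2)[of "p - q" K "q - r"] by simp

lemma lpa_cong_add: "lpa_cong K p q \<Longrightarrow> lpa_cong K p' q' \<Longrightarrow> lpa_cong K (p + p') (q + q')"
  unfolding lpa_cong_def using lpa_ideal_closed(2)[of "p - q" K "p' - q'"] by (simp add: algebra_simps)

lemma lpa_cong_sum: "(\<And>a. a \<in> A \<Longrightarrow> lpa_cong K (f a) (g a)) \<Longrightarrow> lpa_cong K (sum f A) (sum g A)"
  by (induction A rule: infinite_finite_induct) (auto intro: lpa_cong_add)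

lemma lpa_cong_lmult: "lpa_cong K p q \<Longrightarrow> c \<in> carrier (lpa_free K G) \<Longrightarrow> lpa_cong K (c * p) (c * q)"
  unfolding lpa_cong_def using lpa_ideal_closed(4)[of "p - q" K c] by (simp add: algebra_simps)

lemma lpa_cong_rmult: "lpa_cong K p q \<Longrightarrow> c \<in> carrier (lpa_free K G) \<Longrightarrow> lpa_cong K (p * c) (q * c)"
  unfolding lpa_cong_def using lpa_ideal_closed(5)[of "p - q" K c] by (simp add: algebra_simps)

lemma lpa_cong_relations:
  fixes K :: "'k::field itself"
  shows "\<lbrakk>v \<in> verts G; w \<in> verts G\<rbrakk> \<Longrightarrow>
      lpa_cong K (gen (Vertex v) * gen (Vertex w)) (if v = w then gen (Vertex w) else 0)"
    and "e \<in> arcs G \<Longrightarrow> lpa_cong K (gen (Vertex (tail G e)) * gen (Edge e)) (gen (Edge e))"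
    and "e \<in> arcs G \<Longrightarrow> lpa_cong K (gen (Edge e) * gen (Vertex (head G e))) (gen (Edge e))"
    and "e \<in> arcs G \<Longrightarrow> lpa_cong K (gen (Vertex (head G e)) * gen (Ghost e)) (gen (Ghost e))"
    and "e \<in> arcs G \<Longrightarrow> lpa_cong K (gen (Ghost e) * gen (Vertex (tail G e))) (gen (Ghost e))"
    and "\<lbrakk>e \<in> arcs G; f \<in> arcs G\<rbrakk> \<Longrightarrow>
      lpa_cong K (gen (Ghost e) * gen (Edge f)) (if e = f then gen (Vertex (head G e)) else 0)"
    and "regular_vertex G v \<Longrightarrow>
      lpa_cong K (gen (Vertex v)) (\<Sum>e\<in>out_arcs G v. gen (Edge e) * gen (Ghost e))"
  unfolding lpa_cong_def by (rule relation_in_lpa_ideal, unfold lpa_relations_def, blast)+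

definition lpa_class ::
  "'k::field itself \<Rightarrow> (('a, 'b) lpa_gen word \<Rightarrow>\<^sub>0 'k) \<Rightarrow> (('a, 'b) lpa_gen word \<Rightarrow>\<^sub>0 'k) set" where
  "lpa_class K p = lpa_ideal K G +>\<^bsub>lpa_free K G\<^esub> p"

lemma lpa_class_eq_iff: "lpa_class K p = lpa_class K q \<longleftrightarrow> lpa_cong K p q"
proof -
  have cls: "x \<in> lpa_class K p \<longleftrightarrow> lpa_cong K x p" for x p
    unfolding lpa_class_def a_r_coset_def' free_algebra_simps lpa_cong_def
    by (auto simp: algebra_simps) (metis add.commute diff_add_cancel)
  show ?thesis
  proof
    assume "lpa_class K p = lpa_class K q"
    then show "lpa_cong K p q" using cls[of p p] cls[of p q] by simp
  next
    assume pq: "lpa_cong K p q"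
    have "x \<in> lpa_class K p \<longleftrightarrow> x \<in> lpa_class K q" for x
      unfolding cls using lpa_cong_trans[OF _ pq] lpa_cong_trans[OF _ lpa_cong_sym[OF pq]] by blast
    then show "lpa_class K p = lpa_class K q" by blast
  qed
qed

abbreviation nonunital :: "'k::field itself \<Rightarrow> (('a, 'b) lpa_gen word \<Rightarrow>\<^sub>0 'k) set" where
  "nonunital K \<equiv> lpa_free_nonunital K G"

definition homogeneous :: "'k::field itself \<Rightarrow> int \<Rightarrow> (('a, 'b) lpa_gen word \<Rightarrow>\<^sub>0 'k) set" where
  "homogeneous K d = {p \<in> nonunital K. \<forall>w\<in>Poly_Mapping.keys p. word_degree w = d}"

definition unit_sum :: "('a, 'b) lpa_gen word \<Rightarrow>\<^sub>0 'k::field" where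
  "unit_sum = (\<Sum>v\<in>verts G. gen (Vertex v))"

abbreviation LPA :: "'k::field itself \<Rightarrow> (('a, 'b) lpa_gen word \<Rightarrow>\<^sub>0 'k) set ring" where
  "LPA K \<equiv> leavitt_path_algebra K G"

lemma nonunital_carrier: "p \<in> nonunital K \<Longrightarrow> p \<in> carrier (lpa_free K G)"
  by (simp add: lpa_free_nonunital_def)

lemma word_eq_0_iff: "(w :: 'x word) = 0 \<longleftrightarrow> letters w = []"
  by (cases w) (simp add: zero_word_def)

lemma nonunital_closed:
  "0 \<in> nonunital K"
  "\<lbrakk>p \<in> nonunital K; q \<in> nonunital K\<rbrakk> \<Longrightarrow> p + q \<in> nonunital K"
  "\<lbrakk>p \<in> nonunital K; q \<in> carrier (lpa_free K G)\<rbrakk> \<Longrightarrow> p * q \<in> nonunital K"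
  "\<lbrakk>p \<in> carrier (lpa_free K G); q \<in> nonunital K\<rbrakk> \<Longrightarrow> p * q \<in> nonunital K"
proof -
  show "0 \<in> nonunital K" by (simp add: lpa_free_nonunital_def lpa_free_closed)
  show "p + q \<in> nonunital K" if "p \<in> nonunital K" "q \<in> nonunital K"
    using that Poly_Mapping.keys_add[of p q] by (auto simp: lpa_free_nonunital_def lpa_free_closed)
  have sum_0: "u + v = 0 \<longleftrightarrow> u = 0 \<and> v = 0" for u v :: "('a, 'b) lpa_gen word"
    by (auto simp: word_eq_0_iff plus_word_def)
  show "p * q \<in> nonunital K" if "p \<in> nonunital K" "q \<in> carrier (lpa_free K G)"
    using that Poly_Mapping.keys_mult[of p q] by (auto simp: lpa_free_nonunital_def lpa_free_closed sum_0)
  show "p * q \<in> nonunital K" if "p \<in> carrier (lpa_free K G)" "q \<in> nonunital K"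
    using that Poly_Mapping.keys_mult[of p q] by (auto simp: lpa_free_nonunital_def lpa_free_closed sum_0)
qed

lemma nonunital_mult: "\<lbrakk>p \<in> nonunital K; q \<in> nonunital K\<rbrakk> \<Longrightarrow> p * q \<in> nonunital K"
  by (simp add: nonunital_closed nonunital_carrier)

lemma nonunital_sum: "(\<And>a. a \<in> A \<Longrightarrow> f a \<in> nonunital K) \<Longrightarrow> sum f A \<in> nonunital K"
  by (induction A rule: infinite_finite_induct) (auto simp: nonunital_closed)

lemma gen_nonunital: "x \<in> lpa_gens G \<Longrightarrow> gen x \<in> nonunital K"
  using gen_in_lpa_free[of x K] by (simp add: lpa_free_nonunital_def gen_def word_eq_0_iff)

lemma unit_sum_nonunital: "unit_sum \<in> nonunital K"
  unfolding unit_sum_def by (intro nonunital_sum gen_nonunital) simp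

lemma homogeneous_nonunital: "p \<in> homogeneous K d \<Longrightarrow> p \<in> nonunital K"
  by (simp add: homogeneous_def)

lemma homogeneous_zero: "0 \<in> homogeneous K d"
  by (simp add: homogeneous_def nonunital_closed)

lemma homogeneous_add: "\<lbrakk>p \<in> homogeneous K d; q \<in> homogeneous K d\<rbrakk> \<Longrightarrow> p + q \<in> homogeneous K d"
  using Poly_Mapping.keys_add[of p q] by (auto simp: homogeneous_def nonunital_closed)

lemma homogeneous_sum: "(\<And>a. a \<in> A \<Longrightarrow> f a \<in> homogeneous K d) \<Longrightarrow> sum f A \<in> homogeneous K d"
  by (induction A rule: infinite_finite_induct) (auto simp: homogeneous_zero homogeneous_add)

lemma word_degree_add: "word_degree (u + v) = word_degree u + word_degree v"
  by (simp add: word_degree_def plus_word_def)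

lemma homogeneous_mult: "\<lbrakk>p \<in> homogeneous K c; q \<in> homogeneous K d\<rbrakk> \<Longrightarrow> p * q \<in> homogeneous K (c + d)"
  using Poly_Mapping.keys_mult[of p q] by (force simp: homogeneous_def nonunital_mult word_degree_add)

lemma gen_homogeneous: "x \<in> lpa_gens G \<Longrightarrow> gen x \<in> homogeneous K (gen_degree x)"
  using gen_nonunital[of x K] by (auto simp: homogeneous_def gen_def word_degree_def)

lemma LPA_carrier: "carrier (LPA K) = lpa_class K ` nonunital K"
  by (simp add: leavitt_path_algebra_def lpa_class_def[abs_def])

lemma lpa_grading_eq: "lpa_grading K G d = lpa_class K ` homogeneous K d"
  by (simp add: lpa_grading_def lpa_class_def[abs_def] homogeneous_def)

lemma LPA_add:
  assumes "p \<in> nonunital K" "q \<in> nonunital K"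
  shows "lpa_class K p \<oplus>\<^bsub>LPA K\<^esub> lpa_class K q = lpa_class K (p + q)"
  using ideal.a_rcos_sum[OF ideal_lpa_ideal, of p K q] assms[THEN nonunital_carrier]
  by (simp add: leavitt_path_algebra_def lpa_class_def FactRing_def free_algebra_simps)

lemma LPA_mult:
  assumes "p \<in> nonunital K" "q \<in> nonunital K"
  shows "lpa_class K p \<otimes>\<^bsub>LPA K\<^esub> lpa_class K q = lpa_class K (p * q)"
  using ideal.rcoset_mult_add[OF ideal_lpa_ideal, of p K q] assms[THEN nonunital_carrier]
  by (simp add: leavitt_path_algebra_def lpa_class_def FactRing_def free_algebra_simps)

end

context fin_digraph
begin

lemma vertex_carrier [simp]: "v \<in> verts G \<Longrightarrow> gen (Vertex v) \<in> carrier (lpa_free K G)"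
  and edge_carrier [simp]: "e \<in> arcs G \<Longrightarrow> gen (Edge e) \<in> carrier (lpa_free K G)"
  and ghost_carrier [simp]: "e \<in> arcs G \<Longrightarrow> gen (Ghost e) \<in> carrier (lpa_free K G)"
  by (auto intro: gen_in_lpa_free)

lemma unit_sum_vertex:
  assumes "v \<in> verts G"
  shows "lpa_cong K (unit_sum * gen (Vertex v)) (gen (Vertex v))"
    and "lpa_cong K (gen (Vertex v) * unit_sum) (gen (Vertex v))"
proof -
  have "lpa_cong K (unit_sum * gen (Vertex v)) (\<Sum>u\<in>verts G. if u = v then gen (Vertex v) else 0)"
    unfolding unit_sum_def sum_distrib_right using assms by (intro lpa_cong_sum lpa_cong_relations)
  then show "lpa_cong K (unit_sum * gen (Vertex v)) (gen (Vertex v))" using assms by simp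
  have "lpa_cong K (gen (Vertex v) * unit_sum) (\<Sum>u\<in>verts G. if v = u then gen (Vertex u) else 0)"
    unfolding unit_sum_def sum_distrib_left using assms by (intro lpa_cong_sum lpa_cong_relations)
  then show "lpa_cong K (gen (Vertex v) * unit_sum) (gen (Vertex v))" using assms by simp
qed

text \<open>
  Every generator absorbs a vertex on either side, and the sum of the vertices absorbs that vertex.
\<close>

lemma unit_sum_gen:
  assumes "x \<in> lpa_gens G"
  shows "lpa_cong K (unit_sum * gen x) (gen x)" and "lpa_cong K (gen x * unit_sum) (gen x)"
proof -
  have c: "unit_sum \<in> carrier (lpa_free K G)" "gen x \<in> carrier (lpa_free K G)"
    using assms unit_sum_nonunital nonunital_carrier gen_in_lpa_free by auto
  have l: "\<exists>v\<in>verts G. lpa_cong K (gen (Vertex v) * gen x) (gen x)"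
    and r: "\<exists>v\<in>verts G. lpa_cong K (gen x * gen (Vertex v)) (gen x)"
    using assms lpa_cong_relations(1)[of v v for v] lpa_cong_relations(2-5)
    by (fastforce simp: lpa_gens_def)+
  from l obtain v where v: "v \<in> verts G" "lpa_cong K (gen (Vertex v) * gen x) (gen x)" by blast
  have "lpa_cong K (unit_sum * gen x) (unit_sum * gen (Vertex v) * gen x)"
    unfolding mult.assoc by (intro lpa_cong_lmult lpa_cong_sym[OF v(2)] c)
  also have "lpa_cong K \<dots> (gen (Vertex v) * gen x)"
    by (intro lpa_cong_rmult unit_sum_vertex v c)
  also note v(2)
  finally show "lpa_cong K (unit_sum * gen x) (gen x)" .
  from r obtain w where w: "w \<in> verts G" "lpa_cong K (gen x * gen (Vertex w)) (gen x)" by blast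
  have "lpa_cong K (gen x * unit_sum) (gen x * gen (Vertex w) * unit_sum)"
    by (intro lpa_cong_rmult lpa_cong_sym[OF w(2)] c)
  also have "lpa_cong K \<dots> (gen x * gen (Vertex w))"
    unfolding mult.assoc by (intro lpa_cong_lmult unit_sum_vertex w c)
  also note w(2)
  finally show "lpa_cong K (gen x * unit_sum) (gen x)" .
qed

text \<open>
  A nonempty word has a first and a last letter, so the claim for generators suffices. The empty
  word is a genuine exception, since \<open>1\<close> and the sum of the vertices are not congruent.
\<close>

lemma unit_sum_unit:
  assumes p: "p \<in> nonunital K"
  shows "lpa_cong K (unit_sum * p) p" and "lpa_cong K (p * unit_sum) p"
proof -
  let ?s = "\<lambda>w. Poly_Mapping.single w (coeff p w)"
  have expand: "p = (\<Sum>w\<in>Poly_Mapping.keys p. ?s w)" by (rule poly_mapping_eq_sum_single)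
  have l: "lpa_cong K (unit_sum * ?s w) (?s w)" and r: "lpa_cong K (?s w * unit_sum) (?s w)"
    if w: "w \<in> Poly_Mapping.keys p" for w
  proof -
    have ne: "letters w \<noteq> []" and sub: "set (letters w) \<subseteq> lpa_gens G"
      using p w by (auto simp: lpa_free_nonunital_def free_algebra_def simp flip: word_eq_0_iff)
    from ne obtain x xs where x: "letters w = x # xs" by (cases "letters w") auto
    from ne obtain y ys where y: "letters w = ys @ [y]" by (cases "letters w" rule: rev_cases) auto
    let ?t = "Poly_Mapping.single (Word xs) (coeff p w)" and ?u = "Poly_Mapping.single (Word ys) (coeff p w)"
    have "w = Word (x # xs)" using x by (cases w) simp
    then have wx: "?s w = gen x * ?t" by (simp add: gen_def mult_single plus_word_def)
    have "w = Word (ys @ [y])" using y by (cases w) simp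
    then have wy: "?s w = ?u * gen y" by (simp add: gen_def mult_single plus_word_def)
    have c: "?t \<in> carrier (lpa_free K G)" "?u \<in> carrier (lpa_free K G)"
      and gens: "x \<in> lpa_gens G" "y \<in> lpa_gens G"
      using sub[unfolded x] sub[unfolded y] by (auto simp: free_algebra_def)
    show "lpa_cong K (unit_sum * ?s w) (?s w)"
      unfolding wx using lpa_cong_rmult[OF unit_sum_gen(1)[OF gens(1)] c(1)] by (simp add: mult.assoc)
    show "lpa_cong K (?s w * unit_sum) (?s w)"
      unfolding wy using lpa_cong_lmult[OF unit_sum_gen(2)[OF gens(2)] c(2)] by (simp add: mult.assoc)
  qed
  have "lpa_cong K (\<Sum>w\<in>Poly_Mapping.keys p. unit_sum * ?s w) (\<Sum>w\<in>Poly_Mapping.keys p. ?s w)"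
    by (intro lpa_cong_sum l)
  then show "lpa_cong K (unit_sum * p) p" by (simp flip: expand sum_distrib_left)
  have "lpa_cong K (\<Sum>w\<in>Poly_Mapping.keys p. ?s w * unit_sum) (\<Sum>w\<in>Poly_Mapping.keys p. ?s w)"
    by (intro lpa_cong_sum r)
  then show "lpa_cong K (p * unit_sum) p" by (simp flip: expand sum_distrib_right)
qed

end

section \<open>Graded isomorphisms as invertible matrices\<close>

context wf_digraph
begin

definition free_module ::
  "'k::field itself \<Rightarrow> 'i set \<Rightarrow> ('i \<Rightarrow> int) \<Rightarrow>
    ('i \<Rightarrow> (('a, 'b) lpa_gen word \<Rightarrow>\<^sub>0 'k) set, (('a, 'b) lpa_gen word \<Rightarrow>\<^sub>0 'k) set, int) graded_right_module" where
  "free_module K A \<alpha> = direct_sum A (\<lambda>i. graded_shift (regular_module (LPA K) (lpa_grading K G)) (\<alpha> i))"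

text \<open>
  Elements of a finite free module are handled through families of representatives.
\<close>

definition class_vec ::
  "'k::field itself \<Rightarrow> 'i set \<Rightarrow> ('i \<Rightarrow> (('a, 'b) lpa_gen word \<Rightarrow>\<^sub>0 'k)) \<Rightarrow> 'i \<Rightarrow> (('a, 'b) lpa_gen word \<Rightarrow>\<^sub>0 'k) set" where
  "class_vec K A p = (\<lambda>i\<in>A. lpa_class K (p i))"

lemma PiE_image_eq: "(\<Pi>\<^sub>E i\<in>A. f ` S i) = {\<lambda>i\<in>A. f (p i) |p. \<forall>i\<in>A. p i \<in> S i}"
proof (intro equalityI subsetI)
  fix x assume x: "x \<in> (\<Pi>\<^sub>E i\<in>A. f ` S i)"
  then have "\<forall>i\<in>A. \<exists>q. q \<in> S i \<and> x i = f q" by (fastforce simp: PiE_iff)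
  from bchoice[OF this] obtain p where p: "\<forall>i\<in>A. p i \<in> S i \<and> x i = f (p i)" ..
  then have "x = (\<lambda>i\<in>A. f (p i))" using x by (intro extensionalityI[of _ A]) (auto simp: PiE_iff)
  then show "x \<in> {\<lambda>i\<in>A. f (p i) |p. \<forall>i\<in>A. p i \<in> S i}" using p by blast
qed auto

lemma free_module_carrier:
  "carrier (free_module K A \<alpha>) = {class_vec K A p |p. \<forall>i\<in>A. p i \<in> nonunital K}"
  by (simp add: free_module_def direct_sum_def graded_shift_def regular_module_def LPA_carrier
      PiE_image_eq class_vec_def)

lemma free_module_component:
  "component (free_module K A \<alpha>) \<gamma> = {class_vec K A p |p. \<forall>i\<in>A. p i \<in> homogeneous K (\<alpha> i + \<gamma>)}"
  by (simp add: free_module_def direct_sum_def graded_shift_def regular_module_def lpa_grading_eq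
      PiE_image_eq class_vec_def)

lemma class_vec_in_carrier:
  "(\<And>i. i \<in> A \<Longrightarrow> p i \<in> nonunital K) \<Longrightarrow> class_vec K A p \<in> carrier (free_module K A \<alpha>)"
  by (auto simp: free_module_carrier)

lemma class_vec_eq_iff: "class_vec K A p = class_vec K A q \<longleftrightarrow> (\<forall>i\<in>A. lpa_cong K (p i) (q i))"
  unfolding class_vec_def lpa_class_eq_iff[symmetric] by (auto simp: fun_eq_iff restrict_def)

lemma free_module_madd:
  assumes "\<And>i. i \<in> A \<Longrightarrow> p i \<in> nonunital K" "\<And>i. i \<in> A \<Longrightarrow> q i \<in> nonunital K"
  shows "madd (free_module K A \<alpha>) (class_vec K A p) (class_vec K A q) = class_vec K A (\<lambda>i. p i + q i)"
  unfolding free_module_def direct_sum_def graded_shift_def regular_module_def class_vec_def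
  using assms by (simp, intro restrict_ext, simp add: LPA_add)

lemma free_module_ract:
  assumes "\<And>i. i \<in> A \<Longrightarrow> p i \<in> nonunital K" "r \<in> nonunital K"
  shows "ract (free_module K A \<alpha>) (class_vec K A p) (lpa_class K r) = class_vec K A (\<lambda>i. p i * r)"
  unfolding free_module_def direct_sum_def graded_shift_def regular_module_def class_vec_def
  using assms by (simp, intro restrict_ext, simp add: LPA_mult)

definition representative ::
  "'k::field itself \<Rightarrow> 'i set \<Rightarrow> ('i \<Rightarrow> (('a, 'b) lpa_gen word \<Rightarrow>\<^sub>0 'k) set) \<Rightarrow> 'i \<Rightarrow> ('a, 'b) lpa_gen word \<Rightarrow>\<^sub>0 'k" where
  "representative K A x = (SOME p. (\<forall>i\<in>A. p i \<in> nonunital K) \<and> x = class_vec K A p)"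

lemma representative:
  assumes "\<forall>i\<in>A. p i \<in> nonunital K"
  shows "(\<forall>i\<in>A. representative K A (class_vec K A p) i \<in> nonunital K) \<and>
    class_vec K A p = class_vec K A (representative K A (class_vec K A p))"
  unfolding representative_def by (rule someI[where x = p]) (use assms in blast)

definition apply_matrix ::
  "'i set \<Rightarrow> ('j \<Rightarrow> 'i \<Rightarrow> ('a, 'b) lpa_gen word \<Rightarrow>\<^sub>0 'k::field) \<Rightarrow> ('i \<Rightarrow> ('a, 'b) lpa_gen word \<Rightarrow>\<^sub>0 'k) \<Rightarrow>
    'j \<Rightarrow> ('a, 'b) lpa_gen word \<Rightarrow>\<^sub>0 'k" where
  "apply_matrix A t p j = (\<Sum>i\<in>A. t j i * p i)"

definition unit_column :: "'i \<Rightarrow> 'i \<Rightarrow> ('a, 'b) lpa_gen word \<Rightarrow>\<^sub>0 'k::field" where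
  "unit_column i i' = (if i = i' then unit_sum else 0)"

text \<open>
  The equation \<open>s t = 1\<close> over the Leavitt path algebra, for \<open>t\<close> with rows indexed by \<open>B\<close> and columns
  indexed by \<open>A\<close>.
\<close>

definition left_inverse_matrix ::
  "'k::field itself \<Rightarrow> 'i set \<Rightarrow> 'j set \<Rightarrow> ('i \<Rightarrow> 'j \<Rightarrow> ('a, 'b) lpa_gen word \<Rightarrow>\<^sub>0 'k) \<Rightarrow>
    ('j \<Rightarrow> 'i \<Rightarrow> ('a, 'b) lpa_gen word \<Rightarrow>\<^sub>0 'k) \<Rightarrow> bool" where
  "left_inverse_matrix K A B s t \<longleftrightarrow>
     (\<forall>i\<in>A. \<forall>i'\<in>A. lpa_cong K (\<Sum>j\<in>B. s i j * t j i') (unit_column i i'))"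

lemma apply_matrix_nonunital:
  "(\<And>i. i \<in> A \<Longrightarrow> t j i \<in> nonunital K) \<Longrightarrow> (\<And>i. i \<in> A \<Longrightarrow> p i \<in> nonunital K) \<Longrightarrow>
    apply_matrix A t p j \<in> nonunital K"
  unfolding apply_matrix_def by (intro nonunital_sum nonunital_mult)

end

context fin_digraph
begin

lemma unit_column_nonunital: "unit_column i i' \<in> nonunital K"
  by (simp add: unit_column_def unit_sum_nonunital nonunital_closed)

lemma unit_column_commute: "unit_column i i' = unit_column i' i"
  by (simp add: unit_column_def)

lemma left_inverse_matrix_apply:
  assumes "finite A" and inv: "left_inverse_matrix K A B s t"
    and p: "\<And>i. i \<in> A \<Longrightarrow> p i \<in> nonunital K" and i: "i \<in> A"
  shows "lpa_cong K (apply_matrix B s (apply_matrix A t p) i) (p i)"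
proof -
  have "apply_matrix B s (apply_matrix A t p) i = (\<Sum>j\<in>B. \<Sum>i'\<in>A. s i j * t j i' * p i')"
    by (simp add: apply_matrix_def sum_distrib_left mult.assoc)
  also have "\<dots> = (\<Sum>i'\<in>A. (\<Sum>j\<in>B. s i j * t j i') * p i')"
    by (subst sum.swap) (simp add: sum_distrib_right)
  also have "lpa_cong K \<dots> (\<Sum>i'\<in>A. unit_column i i' * p i')"
    using inv i p unfolding left_inverse_matrix_def by (intro lpa_cong_sum lpa_cong_rmult nonunital_carrier) auto
  also have "(\<Sum>i'\<in>A. unit_column i i' * p i') = (\<Sum>i'\<in>A. if i = i' then unit_sum * p i' else 0)"
    by (intro sum.cong) (auto simp: unit_column_def)
  also have "\<dots> = unit_sum * p i" using assms(1) i by simp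
  also have "lpa_cong K \<dots> (p i)" by (rule unit_sum_unit[OF p[OF i]])
  finally show ?thesis .
qed

text \<open>
  The usual argument that a homomorphism is determined by the images \<open>t\<close> of the standard basis. Since
  a family is not given as a sum of its entries in the module record, the entries are added one at a
  time.
\<close>

lemma graded_hom_is_matrix:
  assumes fin: "finite A" and f: "f \<in> graded_hom (LPA K) (free_module K A \<alpha>) (free_module K B \<beta>)"
    and t: "\<And>i j. i \<in> A \<Longrightarrow> j \<in> B \<Longrightarrow> t j i \<in> nonunital K"
    and basis: "\<And>i. i \<in> A \<Longrightarrow> f (class_vec K A (unit_column i)) = class_vec K B (\<lambda>j. t j i)"
    and p: "\<And>i. i \<in> A \<Longrightarrow> p i \<in> nonunital K"
  shows "f (class_vec K A p) = class_vec K B (apply_matrix A t p)"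
proof -
  let ?M = "free_module K A \<alpha>" and ?N = "free_module K B \<beta>"
  have add: "f (madd ?M x y) = madd ?N (f x) (f y)" if "x \<in> carrier ?M" "y \<in> carrier ?M" for x y
    using f that by (auto simp: graded_hom_def)
  have act: "f (ract ?M x (lpa_class K r)) = ract ?N (f x) (lpa_class K r)"
    if "x \<in> carrier ?M" "r \<in> nonunital K" for x r
    using f that by (auto simp: graded_hom_def LPA_carrier)
  have partial: "f (class_vec K A (\<lambda>i. if i \<in> S then p i else 0)) = class_vec K B (apply_matrix S t p)"
    if "S \<subseteq> A" for S
    using finite_subset[OF that fin] that
  proof (induction S rule: finite_induct)
    case empty
    have "class_vec K A (\<lambda>i. 0) \<in> carrier ?M"
      by (rule class_vec_in_carrier) (simp add: nonunital_closed)
    then have "f (class_vec K A (\<lambda>i. 0)) \<in> carrier ?N"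
      using f unfolding graded_hom_def by blast
    then obtain y where y: "f (class_vec K A (\<lambda>i. 0)) = class_vec K B y" "\<forall>j\<in>B. y j \<in> nonunital K"
      unfolding free_module_carrier by blast
    \<comment> \<open>The image of zero is zero because zero is a multiple of zero by the ring element zero.\<close>
    have "f (class_vec K A (\<lambda>i. 0)) = f (ract ?M (class_vec K A (\<lambda>i. 0)) (lpa_class K 0))"
      by (subst free_module_ract) (simp_all add: nonunital_closed)
    also have "\<dots> = ract ?N (class_vec K B y) (lpa_class K 0)"
      by (subst act) (simp_all add: nonunital_closed class_vec_in_carrier y(1))
    also have "\<dots> = class_vec K B (\<lambda>j. 0)"
      using y(2) by (subst free_module_ract) (simp_all add: nonunital_closed)
    finally show ?case by (simp add: apply_matrix_def[abs_def])
  next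
    case (insert a S)
    let ?p = "\<lambda>i. if i \<in> S then p i else 0" and ?q = "\<lambda>i. unit_column a i * p a"
    have a: "a \<in> A" and S: "S \<subseteq> A" using insert.prems by auto
    have N: "?p i \<in> nonunital K" "?q i \<in> nonunital K" "unit_column a i \<in> nonunital K" if "i \<in> A" for i
      using that p a by (auto simp: nonunital_closed unit_column_nonunital intro: nonunital_mult)
    have "class_vec K A (\<lambda>i. if i \<in> insert a S then p i else 0) = class_vec K A (\<lambda>i. ?p i + ?q i)"
      unfolding class_vec_eq_iff
      using insert.hyps unit_sum_unit(1)[OF p[OF a]] lpa_cong_sym by (auto simp: unit_column_def)
    then have "f (class_vec K A (\<lambda>i. if i \<in> insert a S then p i else 0))
        = f (madd ?M (class_vec K A ?p) (class_vec K A ?q))"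
      using N by (subst free_module_madd) simp_all
    also have "\<dots> = madd ?N (f (class_vec K A ?p)) (f (class_vec K A ?q))"
      by (rule add; rule class_vec_in_carrier; fact N)
    also have "f (class_vec K A ?q) = f (ract ?M (class_vec K A (unit_column a)) (lpa_class K (p a)))"
      using N p[OF a] by (subst free_module_ract) auto
    also have "\<dots> = ract ?N (class_vec K B (\<lambda>j. t j a)) (lpa_class K (p a))"
      using N p[OF a] by (subst act) (auto intro: class_vec_in_carrier simp: basis[OF a])
    also have "\<dots> = class_vec K B (\<lambda>j. t j a * p a)"
      using t[OF a] p[OF a] by (subst free_module_ract) auto
    also have "f (class_vec K A ?p) = class_vec K B (apply_matrix S t p)" by (rule insert.IH[OF S])
    also have "madd ?N (class_vec K B (apply_matrix S t p)) (class_vec K B (\<lambda>j. t j a * p a))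
       = class_vec K B (\<lambda>j. apply_matrix S t p j + t j a * p a)"
      using S t p a by (subst free_module_madd) (auto intro!: apply_matrix_nonunital nonunital_mult)
    also have "\<dots> = class_vec K B (apply_matrix (insert a S) t p)"
      using insert.hyps by (simp add: apply_matrix_def[abs_def] add.commute)
    finally show ?case .
  qed
  have "class_vec K A p = class_vec K A (\<lambda>i. if i \<in> A then p i else 0)"
    by (simp add: class_vec_eq_iff)
  then show ?thesis using partial[of A] by simp
qed

text \<open>
  The basis vector at \<open>i\<close> has degree \<open>- \<alpha> i\<close>, hence the entries of \<open>t\<close> can be represented by
  homogeneous elements of degree \<open>\<beta> j - \<alpha> i\<close>. The inverse matrix collects preimages of
  basis vectors, for which any representatives will do.
\<close>

lemma graded_isomorphic_imp_inverse_matrices: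
  assumes fin: "finite A" "finite B"
    and iso: "graded_isomorphic (LPA K) (free_module K A \<alpha>) (free_module K B \<beta>)"
  obtains t s where "\<And>i j. i \<in> A \<Longrightarrow> j \<in> B \<Longrightarrow> t j i \<in> homogeneous K (\<beta> j - \<alpha> i)"
    and "\<And>i j. i \<in> A \<Longrightarrow> j \<in> B \<Longrightarrow> s i j \<in> nonunital K"
    and "left_inverse_matrix K A B s t" and "left_inverse_matrix K B A t s"
proof -
  let ?M = "free_module K A \<alpha>" and ?N = "free_module K B \<beta>"
  from iso obtain f where f: "f \<in> graded_hom (LPA K) ?M ?N" and bij: "bij_betw f (carrier ?M) (carrier ?N)"
    unfolding graded_isomorphic_def by blast
  have "\<exists>c. f (class_vec K A (unit_column i)) = class_vec K B c \<and> (\<forall>j\<in>B. c j \<in> homogeneous K (\<beta> j - \<alpha> i))"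
    if "i \<in> A" for i
  proof -
    have "unit_sum \<in> homogeneous K 0"
      unfolding unit_sum_def using gen_homogeneous[of "Vertex v" K for v] by (intro homogeneous_sum) simp
    then have "class_vec K A (unit_column i) \<in> component ?M (- \<alpha> i)"
      unfolding free_module_component by (auto simp: unit_column_def homogeneous_zero)
    then have "f (class_vec K A (unit_column i)) \<in> component ?N (- \<alpha> i)"
      using f unfolding graded_hom_def by blast
    then show ?thesis unfolding free_module_component by auto
  qed
  then obtain c where c: "\<And>i. i \<in> A \<Longrightarrow> f (class_vec K A (unit_column i)) = class_vec K B (c i)"
    "\<And>i j. i \<in> A \<Longrightarrow> j \<in> B \<Longrightarrow> c i j \<in> homogeneous K (\<beta> j - \<alpha> i)" by metis
  define t where "t j i = c i j" for i j
  have t: "t j i \<in> homogeneous K (\<beta> j - \<alpha> i)" "t j i \<in> nonunital K" if "i \<in> A" "j \<in> B" for i j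
    using c(2)[OF that] by (auto simp: t_def homogeneous_nonunital)
  have f_matrix: "f (class_vec K A p) = class_vec K B (apply_matrix A t p)"
    if "\<And>i. i \<in> A \<Longrightarrow> p i \<in> nonunital K" for p
    using graded_hom_is_matrix[OF fin(1) f, of t p] t(2) c(1) that by (simp add: t_def)
  have "\<exists>d. (\<forall>i\<in>A. d i \<in> nonunital K) \<and> f (class_vec K A d) = class_vec K B (unit_column j)" for j
  proof -
    have "class_vec K B (unit_column j) \<in> f ` carrier ?M"
      using bij class_vec_in_carrier[of B "unit_column j" K \<beta>, OF unit_column_nonunital]
      by (simp add: bij_betw_def)
    then show ?thesis unfolding free_module_carrier by force
  qed
  then obtain d where d: "\<And>i j. i \<in> A \<Longrightarrow> d j i \<in> nonunital K"
    "\<And>j. f (class_vec K A (d j)) = class_vec K B (unit_column j)" by metis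
  define s where "s i j = d j i" for i j
  have TS: "lpa_cong K (\<Sum>i\<in>A. t j' i * s i j) (unit_column j' j)" if "j \<in> B" "j' \<in> B" for j j'
  proof -
    have "class_vec K B (apply_matrix A t (d j)) = class_vec K B (unit_column j)"
      using f_matrix[of "d j"] d by simp
    then show ?thesis
      using that by (simp add: class_vec_eq_iff apply_matrix_def s_def unit_column_commute[of j'])
  qed
  then have TS': "left_inverse_matrix K B A t s"
    unfolding left_inverse_matrix_def by blast
  have "lpa_cong K (\<Sum>j\<in>B. s i j * t j i') (unit_column i i')" if i: "i \<in> A" "i' \<in> A" for i i'
  proof -
    let ?x = "apply_matrix B s (\<lambda>j. t j i')"
    have sN: "s i j \<in> nonunital K" if "i \<in> A" for i j using d(1)[OF that] by (simp add: s_def)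
    have xN: "?x i \<in> nonunital K" if "i \<in> A" for i
      using that i t(2) sN by (intro apply_matrix_nonunital) auto
    have "f (class_vec K A ?x) = class_vec K B (apply_matrix A t ?x)" by (rule f_matrix[OF xN])
    also have "\<dots> = class_vec K B (\<lambda>j. t j i')"
      unfolding class_vec_eq_iff using i t(2) by (intro ballI left_inverse_matrix_apply[OF fin(2) TS']) auto
    also have "\<dots> = f (class_vec K A (unit_column i'))" using c(1)[OF i(2)] by (simp add: t_def)
    finally have "class_vec K A ?x = class_vec K A (unit_column i')"
      using bij_betw_imp_inj_on[OF bij] class_vec_in_carrier[where A = A and p = ?x and \<alpha> = \<alpha>, OF xN]
        class_vec_in_carrier[of A "unit_column i'" K \<alpha>, OF unit_column_nonunital]
      by (blast dest: inj_onD)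
    then show ?thesis using i by (simp add: class_vec_eq_iff apply_matrix_def unit_column_commute[of i])
  qed
  then have "left_inverse_matrix K A B s t" unfolding left_inverse_matrix_def by blast
  then show thesis using that[of t s] t TS' d(1) by (auto simp: s_def)
qed

text \<open>
  Multiplication by a matrix is well defined on classes, so it may be computed on any
  representatives.
\<close>

lemma inverse_matrices_imp_graded_isomorphic:
  assumes fin: "finite A" "finite B"
    and t: "\<And>i j. i \<in> A \<Longrightarrow> j \<in> B \<Longrightarrow> t j i \<in> homogeneous K (\<beta> j - \<alpha> i)"
    and s: "\<And>i j. i \<in> A \<Longrightarrow> j \<in> B \<Longrightarrow> s i j \<in> nonunital K"
    and inv: "left_inverse_matrix K A B s t" "left_inverse_matrix K B A t s"
  shows "graded_isomorphic (LPA K) (free_module K A \<alpha>) (free_module K B \<beta>)"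
proof -
  let ?M = "free_module K A \<alpha>" and ?N = "free_module K B \<beta>"
  have tN: "t j i \<in> nonunital K" if "i \<in> A" "j \<in> B" for i j
    using t[OF that] by (rule homogeneous_nonunital)
  define f where "f x = class_vec K B (apply_matrix A t (representative K A x))" for x
  define g where "g y = class_vec K A (apply_matrix B s (representative K B y))" for y
  have f: "f (class_vec K A p) = class_vec K B (apply_matrix A t p)" if p: "\<forall>i\<in>A. p i \<in> nonunital K" for p
    unfolding f_def class_vec_eq_iff apply_matrix_def using representative[OF p] tN
    by (intro ballI lpa_cong_sum lpa_cong_lmult nonunital_carrier) (auto simp: class_vec_eq_iff intro: lpa_cong_sym)
  have g: "g (class_vec K B p) = class_vec K A (apply_matrix B s p)" if p: "\<forall>i\<in>B. p i \<in> nonunital K" for p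
    unfolding g_def class_vec_eq_iff apply_matrix_def using representative[OF p] s
    by (intro ballI lpa_cong_sum lpa_cong_lmult nonunital_carrier) (auto simp: class_vec_eq_iff intro: lpa_cong_sym)
  have tp: "\<forall>j\<in>B. apply_matrix A t p j \<in> nonunital K" if "\<forall>i\<in>A. p i \<in> nonunital K" for p
    using that tN by (intro ballI apply_matrix_nonunital) auto
  have sp: "\<forall>i\<in>A. apply_matrix B s p i \<in> nonunital K" if "\<forall>j\<in>B. p j \<in> nonunital K" for p
    using that s by (intro ballI apply_matrix_nonunital) auto
  have M: thesis if "x \<in> carrier ?M" "\<And>p. \<lbrakk>x = class_vec K A p; \<forall>i\<in>A. p i \<in> nonunital K\<rbrakk> \<Longrightarrow> thesis" for x thesis
    using that by (auto simp: free_module_carrier)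
  have N: thesis if "x \<in> carrier ?N" "\<And>p. \<lbrakk>x = class_vec K B p; \<forall>i\<in>B. p i \<in> nonunital K\<rbrakk> \<Longrightarrow> thesis" for x thesis
    using that by (auto simp: free_module_carrier)
  have "f \<in> graded_hom (LPA K) ?M ?N"
    unfolding graded_hom_def
  proof (intro CollectI conjI funcsetI ballI allI subsetI)
    fix x assume "x \<in> carrier ?M"
    then show "f x \<in> carrier ?N" by (elim M) (simp add: f tp class_vec_in_carrier)
  next
    fix x y assume "x \<in> carrier ?M" "y \<in> carrier ?M"
    then obtain p q where pq: "x = class_vec K A p" "y = class_vec K A q"
      "\<forall>i\<in>A. p i \<in> nonunital K" "\<forall>i\<in>A. q i \<in> nonunital K" by (elim M) blast
    have "f (madd ?M x y) = f (class_vec K A (\<lambda>i. p i + q i))"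
      using pq by (simp add: free_module_madd)
    also have "\<dots> = class_vec K B (apply_matrix A t (\<lambda>i. p i + q i))"
      using pq by (intro f) (auto intro: nonunital_closed)
    also have "\<dots> = class_vec K B (\<lambda>j. apply_matrix A t p j + apply_matrix A t q j)"
      by (simp add: apply_matrix_def[abs_def] algebra_simps sum.distrib)
    also have "\<dots> = madd ?N (f x) (f y)"
      using pq tp[OF pq(3)] tp[OF pq(4)] by (simp add: f free_module_madd)
    finally show "f (madd ?M x y) = madd ?N (f x) (f y)" .
  next
    fix x r assume "x \<in> carrier ?M" "r \<in> carrier (LPA K)"
    then obtain p r' where pr: "x = class_vec K A p" "\<forall>i\<in>A. p i \<in> nonunital K"
      "r = lpa_class K r'" "r' \<in> nonunital K" by (elim M) (auto simp: LPA_carrier)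
    have "f (ract ?M x r) = f (class_vec K A (\<lambda>i. p i * r'))"
      using pr by (simp add: free_module_ract)
    also have "\<dots> = class_vec K B (apply_matrix A t (\<lambda>i. p i * r'))"
      using pr by (intro f) (auto intro: nonunital_mult)
    also have "\<dots> = class_vec K B (\<lambda>j. apply_matrix A t p j * r')"
      by (simp add: apply_matrix_def[abs_def] sum_distrib_right mult.assoc)
    also have "\<dots> = ract ?N (f x) r"
      using pr tp[OF pr(2)] by (simp add: f free_module_ract)
    finally show "f (ract ?M x r) = ract ?N (f x) r" .
  next
    fix \<gamma> y assume "y \<in> f ` component ?M \<gamma>"
    then obtain p where p: "y = f (class_vec K A p)" "\<forall>i\<in>A. p i \<in> homogeneous K (\<alpha> i + \<gamma>)"
      by (auto simp: free_module_component)
    have "y = class_vec K B (apply_matrix A t p)"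
      using p homogeneous_nonunital by (auto intro!: f)
    moreover have "apply_matrix A t p j \<in> homogeneous K (\<beta> j + \<gamma>)" if "j \<in> B" for j
      unfolding apply_matrix_def
    proof (rule homogeneous_sum)
      fix i assume "i \<in> A"
      with homogeneous_mult[OF t[OF _ that], of i "p i" "\<alpha> i + \<gamma>"] p(2)
      show "t j i * p i \<in> homogeneous K (\<beta> j + \<gamma>)" by simp
    qed
    ultimately show "y \<in> component ?N \<gamma>" unfolding free_module_component by blast
  qed
  moreover have "bij_betw f (carrier ?M) (carrier ?N)"
  proof (rule bij_betw_byWitness[where f' = g])
    show "\<forall>x\<in>carrier ?M. g (f x) = x"
    proof
      fix x assume "x \<in> carrier ?M"
      then obtain p where p: "x = class_vec K A p" "\<forall>i\<in>A. p i \<in> nonunital K" by (elim M) blast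
      show "g (f x) = x" using p left_inverse_matrix_apply[OF fin(1) inv(1), of p]
        by (simp add: f g tp class_vec_eq_iff)
    qed
    show "\<forall>y\<in>carrier ?N. f (g y) = y"
    proof
      fix y assume "y \<in> carrier ?N"
      then obtain p where p: "y = class_vec K B p" "\<forall>i\<in>B. p i \<in> nonunital K" by (elim N) blast
      show "f (g y) = y" using p left_inverse_matrix_apply[OF fin(2) inv(2), of p]
        by (simp add: f g sp class_vec_eq_iff)
    qed
    show "f ` carrier ?M \<subseteq> carrier ?N"
      by (intro image_subsetI, elim M) (simp add: f tp class_vec_in_carrier)
    show "g ` carrier ?N \<subseteq> carrier ?M"
      by (intro image_subsetI, elim N) (simp add: g sp class_vec_in_carrier)
  qed
  ultimately show ?thesis unfolding graded_isomorphic_def by blast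
qed

end

section \<open>Graded isomorphisms from matched walks\<close>

text \<open>
  Bijections between the fibres are glued along the base.
\<close>

lemma fibrewise_bijection:
  assumes fin: "finite P" "finite Q"
    and card: "\<And>w. card {x \<in> P. r x = w} = card {y \<in> Q. r' y = w}"
  obtains \<phi> where "bij_betw \<phi> P Q" "\<And>x. x \<in> P \<Longrightarrow> r' (\<phi> x) = r x"
proof -
  have "\<exists>g. bij_betw g {x \<in> P. r x = w} {y \<in> Q. r' y = w}" for w
    by (rule finite_same_card_bij) (use fin card in auto)
  then obtain g where g: "\<And>w. bij_betw (g w) {x \<in> P. r x = w} {y \<in> Q. r' y = w}" by metis
  define \<phi> where "\<phi> x = g (r x) x" for x
  have \<phi>: "\<phi> x \<in> Q" "r' (\<phi> x) = r x" if "x \<in> P" for x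
    using bij_betwE[OF g[of "r x"]] that by (auto simp: \<phi>_def)
  have "inj_on \<phi> P"
  proof (rule inj_onI)
    fix x y assume xy: "x \<in> P" "y \<in> P" "\<phi> x = \<phi> y"
    then have "r x = r y" using \<phi>(2) by metis
    then show "x = y" using bij_betw_imp_inj_on[OF g[of "r x"]] xy by (auto simp: \<phi>_def dest: inj_onD)
  qed
  moreover have "y \<in> \<phi> ` P" if "y \<in> Q" for y
  proof -
    have "y \<in> g (r' y) ` {x \<in> P. r x = r' y}" using bij_betw_imp_surj_on[OF g[of "r' y"]] that by auto
    then obtain x where "x \<in> P" "r x = r' y" "y = \<phi> x" by (auto simp: \<phi>_def)
    then show ?thesis by blast
  qed
  ultimately have "bij_betw \<phi> P Q" using \<phi>(1) by (auto simp: bij_betw_def)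
  then show thesis using that \<phi>(2) by blast
qed

context fin_digraph
begin

text \<open>
  The monomials \<open>\<mu>\<close> and \<open>\<mu>\<^sup>*\<close> of a walk. The trailing and leading vertex make them nonempty words
  even for a walk of length zero, and record its end.
\<close>

fun path_elt :: "'a \<Rightarrow> 'b list \<Rightarrow> ('a, 'b) lpa_gen word \<Rightarrow>\<^sub>0 'k::field" where
  "path_elt u [] = gen (Vertex u)"
| "path_elt u (e # es) = gen (Edge e) * path_elt (head G e) es"

fun ghost_path_elt :: "'a \<Rightarrow> 'b list \<Rightarrow> ('a, 'b) lpa_gen word \<Rightarrow>\<^sub>0 'k::field" where
  "ghost_path_elt u [] = gen (Vertex u)"
| "ghost_path_elt u (e # es) = ghost_path_elt (head G e) es * gen (Ghost e)"

lemma path_elt_homogeneous: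
  "awalk u es w \<Longrightarrow> path_elt u es \<in> homogeneous K (int (length es))"
proof (induction es arbitrary: u)
  case Nil
  then show ?case using gen_homogeneous[of "Vertex u" K] by (auto simp: awalk_Nil_iff)
next
  case (Cons e es)
  then have e: "e \<in> arcs G" "awalk (head G e) es w" by (auto simp: awalk_Cons_iff)
  show ?case using homogeneous_mult[OF gen_homogeneous[of "Edge e" K] Cons.IH[OF e(2)]] e(1)
    by (simp add: algebra_simps)
qed

lemma ghost_path_elt_homogeneous:
  "awalk u es w \<Longrightarrow> ghost_path_elt u es \<in> homogeneous K (- int (length es))"
proof (induction es arbitrary: u)
  case Nil
  then show ?case using gen_homogeneous[of "Vertex u" K] by (auto simp: awalk_Nil_iff)
next
  case (Cons e es)
  then have e: "e \<in> arcs G" "awalk (head G e) es w" by (auto simp: awalk_Cons_iff)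
  show ?case using homogeneous_mult[OF Cons.IH[OF e(2)] gen_homogeneous[of "Ghost e" K]] e(1)
    by (simp add: algebra_simps)
qed

lemma path_elt_carrier:
  "awalk u es w \<Longrightarrow> path_elt u es \<in> carrier (lpa_free K G)"
  "awalk u es w \<Longrightarrow> ghost_path_elt u es \<in> carrier (lpa_free K G)"
  using path_elt_homogeneous ghost_path_elt_homogeneous homogeneous_nonunital nonunital_carrier by blast+

lemma source_path_elt:
  assumes "awalk u es w"
  shows "lpa_cong K (gen (Vertex u) * path_elt u es) (path_elt u es)"
proof (cases es)
  case Nil
  then show ?thesis using assms lpa_cong_relations(1)[of u u K] by (auto simp: awalk_Nil_iff)
next
  case (Cons e es')
  then have e: "e \<in> arcs G" "u = tail G e" "awalk (head G e) es' w"
    using assms by (auto simp: awalk_Cons_iff)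
  show ?thesis
    using lpa_cong_rmult[OF lpa_cong_relations(2)[OF e(1)] path_elt_carrier(1)[OF e(3)]]
    by (simp add: Cons e(2) mult.assoc)
qed

lemma path_elt_range:
  assumes "awalk u es w"
  shows "lpa_cong K (path_elt u es * gen (Vertex w)) (path_elt u es)"
  using assms
proof (induction es arbitrary: u)
  case Nil
  then show ?case using lpa_cong_relations(1)[of u u K] by (auto simp: awalk_Nil_iff)
next
  case (Cons e es)
  then have e: "e \<in> arcs G" "awalk (head G e) es w" by (auto simp: awalk_Cons_iff)
  show ?case using lpa_cong_lmult[OF Cons.IH[OF e(2)] edge_carrier[OF e(1)]] by (simp add: mult.assoc)
qed

text \<open>
  Cancelling letters from the middle outwards. Equal lengths rule out the case that one walk is a proper
  prefix of the other.
\<close>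

lemma ghost_path_elt_mult_path_elt:
  assumes "length es = length es'" "awalk u es w" "awalk u' es' w'"
  shows "lpa_cong K (ghost_path_elt u es * path_elt u' es')
    (if (u, es) = (u', es') then gen (Vertex w) else 0)"
  using assms
proof (induction es es' arbitrary: u u' rule: list_induct2)
  case Nil
  then show ?case using lpa_cong_relations(1)[of u u' K] by (auto simp: awalk_Nil_iff)
next
  case (Cons e es e' es')
  then have e: "e \<in> arcs G" "u = tail G e" "awalk (head G e) es w"
    and e': "e' \<in> arcs G" "u' = tail G e'" "awalk (head G e') es' w'" by (auto simp: awalk_Cons_iff)
  let ?g = "ghost_path_elt (head G e) es :: ('a, 'b) lpa_gen word \<Rightarrow>\<^sub>0 'c"
  let ?p = "path_elt (head G e') es' :: ('a, 'b) lpa_gen word \<Rightarrow>\<^sub>0 'c"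
  have c: "?g \<in> carrier (lpa_free K G)" "?p \<in> carrier (lpa_free K G)"
    using path_elt_carrier e(3) e'(3) by auto
  have "ghost_path_elt u (e # es) * path_elt u' (e' # es') = ?g * (gen (Ghost e) * gen (Edge e') * ?p)"
    by (simp add: mult.assoc)
  also have "lpa_cong K \<dots> (?g * ((if e = e' then gen (Vertex (head G e)) else 0) * ?p))"
    using lpa_cong_relations(6)[OF e(1) e'(1)] c by (intro lpa_cong_lmult lpa_cong_rmult)
  also have "lpa_cong K \<dots> (if e = e' then ?g * ?p else 0)"
    using source_path_elt[OF e'(3)] c by (auto intro!: lpa_cong_lmult)
  also have "lpa_cong K \<dots> (if (u, e # es) = (u', e' # es') then gen (Vertex w) else 0)"
    using Cons.IH[OF e(3) e'(3)] e(2) e'(2) by auto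
  finally show ?case .
qed

definition walks_from :: "'a \<Rightarrow> nat \<Rightarrow> 'b list set" where
  "walks_from u k = {es. (\<exists>w. awalk u es w) \<and> length es = k}"

definition walks :: "nat \<Rightarrow> ('a \<times> 'b list) set" where
  "walks k = (SIGMA u:verts G. walks_from u k)"

lemma finite_walks_from: "finite (walks_from u k)"
  by (rule finite_subset[OF _ finite_lists_length_eq[of "arcs G" k]])
    (auto simp: walks_from_def awalk_def)

lemma finite_walks: "finite (walks k)"
  by (auto simp: walks_def finite_walks_from)

lemma walks_iff: "(u, es) \<in> walks k \<longleftrightarrow> (\<exists>w. awalk u es w) \<and> length es = k"
  by (auto simp: walks_def walks_from_def awalk_def)

lemma walks_from_Suc:
  assumes "u \<in> verts G"
  shows "walks_from u (Suc k) = (\<lambda>(e, es). e # es) ` (SIGMA e:out_arcs G u. walks_from (head G e) k)"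
  by (auto simp: walks_from_def length_Suc_conv awalk_Cons_iff image_iff)

text \<open>
  The relation \<open>u = \<Sum> e e\<^sup>*\<close> applied \<open>k\<close> times; it can be repeated because no vertex met on the way is
  a sink.
\<close>

lemma vertex_eq_sum_paths:
  assumes no_sink: "\<forall>v\<in>verts G. \<not> sink G v" and u: "u \<in> verts G"
  shows "lpa_cong K (\<Sum>es\<in>walks_from u k. path_elt u es * ghost_path_elt u es) (gen (Vertex u))"
  using u
proof (induction k arbitrary: u)
  case 0
  then have "walks_from u 0 = {[]}" by (auto simp: walks_from_def awalk_Nil_iff)
  then show ?case using lpa_cong_relations(1)[of u u K] 0 by simp
next
  case (Suc k)
  let ?pg = "\<lambda>u es. path_elt u es * ghost_path_elt u es :: ('a, 'b) lpa_gen word \<Rightarrow>\<^sub>0 'c"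
  have "(\<Sum>es\<in>walks_from u (Suc k). ?pg u es)
      = (\<Sum>(e, es)\<in>(SIGMA e:out_arcs G u. walks_from (head G e) k). ?pg u (e # es))"
    unfolding walks_from_Suc[OF Suc.prems]
    by (subst sum.reindex) (auto simp: inj_on_def case_prod_unfold)
  also have "\<dots> = (\<Sum>e\<in>out_arcs G u. \<Sum>es\<in>walks_from (head G e) k. ?pg u (e # es))"
    by (rule sum.Sigma[symmetric]) (auto simp: finite_walks_from)
  also have "\<dots> = (\<Sum>e\<in>out_arcs G u. gen (Edge e) * ((\<Sum>es\<in>walks_from (head G e) k. ?pg (head G e) es) * gen (Ghost e)))"
    by (simp add: sum_distrib_left sum_distrib_right mult.assoc)
  also have "lpa_cong K \<dots> (\<Sum>e\<in>out_arcs G u. gen (Edge e) * (gen (Vertex (head G e)) * gen (Ghost e)))"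
    by (intro lpa_cong_sum lpa_cong_lmult lpa_cong_rmult Suc.IH) auto
  also have "lpa_cong K \<dots> (\<Sum>e\<in>out_arcs G u. gen (Edge e) * gen (Ghost e))"
    by (intro lpa_cong_sum lpa_cong_lmult lpa_cong_relations) auto
  also have "lpa_cong K \<dots> (gen (Vertex u))"
    using no_sink Suc.prems
    by (intro lpa_cong_sym[OF lpa_cong_relations(7)]) (auto simp: regular_vertex_def sink_def)
  finally show ?case .
qed

lemma unit_sum_eq_sum_paths:
  assumes no_sink: "\<forall>v\<in>verts G. \<not> sink G v"
  shows "lpa_cong K (\<Sum>(u, es)\<in>walks k. path_elt u es * ghost_path_elt u es) unit_sum"
proof -
  have "(\<Sum>(u, es)\<in>walks k. path_elt u es * ghost_path_elt u es)
      = (\<Sum>u\<in>verts G. \<Sum>es\<in>walks_from u k. path_elt u es * ghost_path_elt u es :: ('a, 'b) lpa_gen word \<Rightarrow>\<^sub>0 'c)"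
    unfolding walks_def by (rule sum.Sigma[symmetric]) (auto simp: finite_walks_from)
  also have "lpa_cong K \<dots> (\<Sum>u\<in>verts G. gen (Vertex u))"
    by (intro lpa_cong_sum vertex_eq_sum_paths no_sink)
  finally show ?thesis by (simp add: unit_sum_def)
qed

text \<open>
  Two families \<open>a\<close>, \<open>b\<close> of labelled walks, indexed by the same set \<open>X\<close>, give the matrix with entries
  \<open>\<Sum> \<mu> \<nu>\<^sup>*\<close>, taken over the pairs \<open>(\<mu>, \<nu>)\<close> of matched walks with labels \<open>i\<close> and \<open>j\<close>.
\<close>

definition matching_matrix ::
  "'x set \<Rightarrow> ('x \<Rightarrow> 'i \<times> 'a \<times> 'b list) \<Rightarrow> ('x \<Rightarrow> 'j \<times> 'a \<times> 'b list) \<Rightarrow> 'i \<Rightarrow> 'j \<Rightarrow>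
    ('a, 'b) lpa_gen word \<Rightarrow>\<^sub>0 'k::field" where
  "matching_matrix X a b i j = (\<Sum>x\<in>{x \<in> X. fst (a x) = i \<and> fst (b x) = j}.
     case_prod path_elt (snd (a x)) * case_prod ghost_path_elt (snd (b x)))"

lemma matching_matrix_homogeneous:
  assumes "a ` X \<subseteq> (SIGMA i:A. walks (p i))" "b ` X \<subseteq> (SIGMA j:B. walks (q j))"
  shows "matching_matrix X a b i j \<in> homogeneous K (int (p i) - int (q j))"
  unfolding matching_matrix_def
proof (rule homogeneous_sum)
  fix x assume x: "x \<in> {x \<in> X. fst (a x) = i \<and> fst (b x) = j}"
  then have "snd (a x) \<in> walks (p i)" "snd (b x) \<in> walks (q j)" using assms by force+
  then obtain u es v fs w w' where 1: "snd (a x) = (u, es)" "awalk u es w" "length es = p i"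
    "snd (b x) = (v, fs)" "awalk v fs w'" "length fs = q j"
    by (cases "snd (a x)"; cases "snd (b x)") (auto simp: walks_iff)
  show "case_prod path_elt (snd (a x)) * case_prod ghost_path_elt (snd (b x)) \<in> homogeneous K (int (p i) - int (q j))"
    using homogeneous_mult[OF path_elt_homogeneous[OF 1(2), of K] ghost_path_elt_homogeneous[OF 1(5)]] 1 by simp
qed

text \<open>
  In the product of the two matrices, \<open>\<mu> \<nu>\<^sup>* \<nu>' \<mu>'\<^sup>*\<close> vanishes unless \<open>\<nu> = \<nu>'\<close>, because walks with the
  same label have the same length. What remains is \<open>\<mu> \<mu>\<^sup>*\<close>, since matched walks have the same end,
  and these terms add up to the identity.
\<close>

lemma matching_matrix_left_inverse:
  fixes K :: "'k::field itself"
  assumes no_sink: "\<forall>v\<in>verts G. \<not> sink G v"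
    and fin: "finite X" "finite B"
    and a: "bij_betw a X (SIGMA i:A. walks (p i))"
    and b: "inj_on b X" "b ` X \<subseteq> (SIGMA j:B. walks (q j))"
    and range: "\<And>x. x \<in> X \<Longrightarrow> case_prod awlast (snd (a x)) = case_prod awlast (snd (b x))"
  shows "left_inverse_matrix K A B (matching_matrix X a b) (matching_matrix X b a)"
  unfolding left_inverse_matrix_def
proof (intro ballI)
  fix i i' assume i: "i \<in> A" "i' \<in> A"
  let ?pa = "\<lambda>x. case_prod path_elt (snd (a x)) :: ('a, 'b) lpa_gen word \<Rightarrow>\<^sub>0 'k"
    and ?ga = "\<lambda>x. case_prod ghost_path_elt (snd (a x)) :: ('a, 'b) lpa_gen word \<Rightarrow>\<^sub>0 'k"
    and ?pb = "\<lambda>x. case_prod path_elt (snd (b x)) :: ('a, 'b) lpa_gen word \<Rightarrow>\<^sub>0 'k"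
    and ?gb = "\<lambda>x. case_prod ghost_path_elt (snd (b x)) :: ('a, 'b) lpa_gen word \<Rightarrow>\<^sub>0 'k"
  let ?X = "\<lambda>i j. {x \<in> X. fst (a x) = i \<and> fst (b x) = j}"
  have walk_a: "\<exists>u es w. snd (a x) = (u, es) \<and> awalk u es w \<and> case_prod awlast (snd (a x)) = w" if "x \<in> X" for x
    using bij_betwE[OF a] that by (cases "snd (a x)") (fastforce simp: walks_iff awlast_of_awalk)
  have walk_b: "\<exists>u es w. snd (b x) = (u, es) \<and> awalk u es w \<and> case_prod awlast (snd (b x)) = w \<and> length es = q (fst (b x))" if "x \<in> X" for x
  proof -
    have "b x \<in> (SIGMA j:B. walks (q j))" using b(2) that by blast
    then show ?thesis by (cases "snd (b x)") (fastforce simp: walks_iff awlast_of_awalk)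
  qed
  have pair: "lpa_cong K ((?pa x * ?gb x) * (?pb y * ?ga y)) (if y = x then ?pa x * ?ga x else 0)"
    if xy: "x \<in> X" "y \<in> X" "fst (b x) = fst (b y)" for x y
  proof -
    from walk_a[OF xy(1)] obtain u es w where ax: "snd (a x) = (u, es)" "awalk u es w"
      "case_prod awlast (snd (a x)) = w" by blast
    from walk_a[OF xy(2)] obtain u' es' w' where ay: "snd (a y) = (u', es')" "awalk u' es' w'" by blast
    from walk_b[OF xy(1)] obtain v fs z where bx: "snd (b x) = (v, fs)" "awalk v fs z"
      "case_prod awlast (snd (b x)) = z" "length fs = q (fst (b x))" by blast
    from walk_b[OF xy(2)] obtain v' fs' z' where bY: "snd (b y) = (v', fs')" "awalk v' fs' z'"
      "length fs' = q (fst (b y))" by blast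
    have eq: "(v, fs) = (v', fs') \<longleftrightarrow> y = x"
      using xy bx(1) bY(1) inj_onD[OF b(1), of y x] by (metis prod.expand)
    have zw: "z = w" using range[OF xy(1)] ax(3) bx(3) by simp
    have "(?pa x * ?gb x) * (?pb y * ?ga y) = ?pa x * ((?gb x * ?pb y) * ?ga y)" by (simp add: mult.assoc)
    also have "lpa_cong K \<dots> (?pa x * ((if y = x then gen (Vertex z) else 0) * ?ga y))"
      using ghost_path_elt_mult_path_elt[of fs fs' v z v' z' K, unfolded eq] bx bY xy(3) ax ay
      by (intro lpa_cong_lmult lpa_cong_rmult) (simp_all add: path_elt_carrier)
    also have "\<dots> = (if y = x then (?pa x * gen (Vertex w)) * ?ga x else 0)"
      by (simp add: zw mult.assoc)
    also have "lpa_cong K \<dots> (if y = x then ?pa x * ?ga x else 0)"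
      using ax by (auto intro!: lpa_cong_rmult path_elt_range path_elt_carrier)
    finally show ?thesis .
  qed
  have "(\<Sum>j\<in>B. matching_matrix X a b i j * matching_matrix X b a j i')
      = (\<Sum>j\<in>B. \<Sum>x\<in>?X i j. \<Sum>y\<in>?X i' j. (?pa x * ?gb x) * (?pb y * ?ga y))"
    unfolding matching_matrix_def sum_product by (simp add: conj_commute)
  also have "lpa_cong K \<dots> (\<Sum>j\<in>B. \<Sum>x\<in>?X i j. \<Sum>y\<in>?X i' j. if y = x then ?pa x * ?ga x else 0)"
    by (intro lpa_cong_sum pair) auto
  also have "\<dots> = (\<Sum>j\<in>B. \<Sum>x\<in>?X i j. if i = i' then ?pa x * ?ga x else 0)"
    using fin by (intro sum.cong) auto
  also have "\<dots> = (\<Sum>j\<in>B. \<Sum>x\<in>{x \<in> {x \<in> X. fst (a x) = i}. fst (b x) = j}. if i = i' then ?pa x * ?ga x else 0)"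
    by (intro sum.cong) auto
  also have "\<dots> = (\<Sum>x\<in>{x \<in> X. fst (a x) = i}. if i = i' then ?pa x * ?ga x else 0)"
    using fin b(2) by (intro sum.group) auto
  also have "\<dots> = (if i = i' then (\<Sum>(u, es)\<in>walks (p i). path_elt u es * ghost_path_elt u es) else 0)"
  proof -
    have "bij_betw (snd \<circ> a) {x \<in> X. fst (a x) = i} (walks (p i))"
    proof (rule bij_betw_imageI)
      show "inj_on (snd \<circ> a) {x \<in> X. fst (a x) = i}"
        using bij_betw_imp_inj_on[OF a] by (auto simp: inj_on_def prod_eq_iff)
      show "(snd \<circ> a) ` {x \<in> X. fst (a x) = i} = walks (p i)"
      proof (intro equalityI subsetI)
        fix \<mu> assume "\<mu> \<in> (snd \<circ> a) ` {x \<in> X. fst (a x) = i}"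
        then show "\<mu> \<in> walks (p i)" using bij_betwE[OF a] by force
      next
        fix \<mu> assume "\<mu> \<in> walks (p i)"
        then have "(i, \<mu>) \<in> a ` X" using i bij_betw_imp_surj_on[OF a] by simp
        then obtain x where "x \<in> X" "a x = (i, \<mu>)" by force
        then show "\<mu> \<in> (snd \<circ> a) ` {x \<in> X. fst (a x) = i}" by (force simp: image_iff)
      qed
    qed
    from sum.reindex_bij_betw[OF this, of "\<lambda>(u, es). path_elt u es * ghost_path_elt u es"]
    show ?thesis by (cases "i = i'") (simp_all add: case_prod_unfold)
  qed
  also have "lpa_cong K \<dots> (unit_column i i')"
    using unit_sum_eq_sum_paths[OF no_sink, of K "p i"] by (cases "i = i'") (simp_all add: unit_column_def)
  finally show "lpa_cong K (\<Sum>j\<in>B. matching_matrix X a b i j * matching_matrix X b a j i') (unit_column i i')" .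
qed

lemma walks_fibre:
  assumes "finite A"
  shows "card {x \<in> (SIGMA i:A. walks (p i)). case_prod awlast (snd x) = w} = (\<Sum>i\<in>A. card (walks_into w (p i)))"
proof -
  have "{x \<in> (SIGMA i:A. walks (p i)). case_prod awlast (snd x) = w} = (SIGMA i:A. walks_into w (p i))"
    by (auto simp: walks_iff walks_into_def awlast_of_awalk)
  then show ?thesis using assms finite_walks_into by (simp add: card_SigmaI)
qed

text \<open>
  Equal counts allow the walks on both sides to be matched so that the ends agree. With
  the exponents as shifts the matching matrix preserves degrees, because \<open>\<nu> \<mu>\<^sup>*\<close> has degree
  \<open>q j - p i\<close>.
\<close>

lemma equal_walk_counts_imp_graded_isomorphic:
  fixes K :: "'k::field itself"
  assumes no_sink: "\<forall>v\<in>verts G. \<not> sink G v" and fin: "finite A" "finite B"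
    and counts: "\<And>w. w \<in> verts G \<Longrightarrow> (\<Sum>i\<in>A. card (walks_into w (p i))) = (\<Sum>j\<in>B. card (walks_into w (q j)))"
  shows "graded_isomorphic (LPA K) (free_module K A (\<lambda>i. int (p i))) (free_module K B (\<lambda>j. int (q j)))"
proof -
  let ?P = "SIGMA i:A. walks (p i)" and ?Q = "SIGMA j:B. walks (q j)"
  have fPQ: "finite ?P" "finite ?Q" using fin finite_walks by auto
  have into: "walks_into w k = {}" if "w \<notin> verts G" for w k
    using that by (auto simp: walks_into_def dest: awalk_last_in_verts)
  have "(\<Sum>i\<in>A. card (walks_into w (p i))) = (\<Sum>j\<in>B. card (walks_into w (q j)))" for w
    by (cases "w \<in> verts G") (auto simp: counts into)
  then have "card {x \<in> ?P. case_prod awlast (snd x) = w} = card {y \<in> ?Q. case_prod awlast (snd y) = w}" for w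
    by (simp only: walks_fibre fin)
  from fibrewise_bijection[OF fPQ this] obtain \<phi> where \<phi>: "bij_betw \<phi> ?P ?Q"
    "\<And>x. x \<in> ?P \<Longrightarrow> case_prod awlast (snd (\<phi> x)) = case_prod awlast (snd x)" by blast
  note inj = bij_betw_imp_inj_on[OF \<phi>(1)] and surj = bij_betw_imp_surj_on[OF \<phi>(1)]
  have hom: "matching_matrix ?P \<phi> id j i \<in> homogeneous K (int (q j) - int (p i))"
    "matching_matrix ?P id \<phi> i j \<in> homogeneous K (int (p i) - int (q j))" for i j
    using matching_matrix_homogeneous[of \<phi> ?P B q id A p] matching_matrix_homogeneous[of id ?P A p \<phi> B q]
    by (simp_all add: surj)
  show ?thesis
  proof (rule inverse_matrices_imp_graded_isomorphic[OF fin hom(1) homogeneous_nonunital[OF hom(2)]])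
    show "left_inverse_matrix K A B (matching_matrix ?P id \<phi>) (matching_matrix ?P \<phi> id)"
      by (rule matching_matrix_left_inverse[OF no_sink fPQ(1) fin(2)]) (use inj surj \<phi>(2) in auto)
    show "left_inverse_matrix K B A (matching_matrix ?P \<phi> id) (matching_matrix ?P id \<phi>)"
      by (rule matching_matrix_left_inverse[OF no_sink fPQ(1) fin(1) \<phi>(1)]) (use \<phi>(2) in auto)
  qed
qed

end

section \<open>Walk counts from graded isomorphisms\<close>

context fin_digraph
begin

definition indicator_of :: "'x \<Rightarrow> 'x \<Rightarrow> 'k::field" where
  "indicator_of x y = (if x = y then 1 else 0)"

text \<open>
  Expansion of a function in indicator functions of the finite set \<open>W\<close>, which is legitimate if the
  function vanishes at those reachable walks that lie outside \<open>W\<close>.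
\<close>

lemma pull_expand:
  assumes p: "p \<in> carrier (lpa_free K G)" and \<mu>: "awalk u es w" and fin: "finite W"
    and out: "\<And>u' es' a. a \<in> Poly_Mapping.keys p \<Longrightarrow> awalk u' es' w \<Longrightarrow>
      int (length es') = int (length es) + word_degree a \<Longrightarrow> (u', es') \<notin> W \<Longrightarrow> \<phi> (u', es') = 0"
  shows "(\<Sum>\<nu>\<in>W. \<phi> \<nu> * pull (indicator_of \<nu>) p (u, es)) = pull \<phi> p (u, es)"
proof -
  have "pull \<phi> p (u, es) = pull (\<lambda>x. \<Sum>\<nu>\<in>W. \<phi> \<nu> * indicator_of \<nu> x) p (u, es)"
  proof (rule pull_local[OF p \<mu>])
    fix u' es' a assume *: "a \<in> Poly_Mapping.keys p" "awalk u' es' w"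
      "int (length es') = int (length es) + word_degree a"
    have "(\<Sum>\<nu>\<in>W. \<phi> \<nu> * indicator_of \<nu> (u', es')) = (\<Sum>\<nu>\<in>W. if \<nu> = (u', es') then \<phi> \<nu> else 0)"
      by (intro sum.cong) (auto simp: indicator_of_def)
    also have "\<dots> = (if (u', es') \<in> W then \<phi> (u', es') else 0)" using fin by simp
    also have "\<dots> = \<phi> (u', es')" using out[OF *] by auto
    finally show "\<phi> (u', es') = (\<Sum>\<nu>\<in>W. \<phi> \<nu> * indicator_of \<nu> (u', es'))" by simp
  qed
  then show ?thesis by (simp add: pull_sum_fun)
qed

lemma pull_unit_column:
  assumes "awalk u es w"
  shows "pull \<phi> (unit_column i i') (u, es) = (if i = i' then \<phi> (u, es) else 0)"
proof -
  have "pull \<phi> unit_sum (u, es) = (\<Sum>v\<in>verts G. if v = u then \<phi> (u, es) else 0)"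
    unfolding unit_sum_def pull_sum by (intro sum.cong) (auto simp: pull_def act_def)
  also have "\<dots> = \<phi> (u, es)" using awalk_hd_in_verts[OF assms] by simp
  finally show ?thesis by (simp add: unit_column_def)
qed

definition agree_on_long_walks :: "nat \<Rightarrow> (('a, 'b) lpa_gen word \<Rightarrow>\<^sub>0 'k::field) \<Rightarrow> (('a, 'b) lpa_gen word \<Rightarrow>\<^sub>0 'k) \<Rightarrow> bool" where
  "agree_on_long_walks N p q \<longleftrightarrow>
     (\<forall>\<phi> u es w. awalk u es w \<longrightarrow> N \<le> length es \<longrightarrow> pull \<phi> p (u, es) = pull \<phi> q (u, es))"

lemma lpa_cong_agree_on_long_walks:
  assumes "lpa_cong K p q"
  shows "\<forall>\<^sub>F N in sequentially. agree_on_long_walks N p q"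
proof -
  from assms have "p - q \<in> vanishing_on_long_walks K"
    using lpa_ideal_vanishes_on_long_walks by (auto simp: lpa_cong_def)
  then obtain N where "\<forall>\<phi> u es w. awalk u es w \<longrightarrow> N \<le> length es \<longrightarrow> pull \<phi> (p - q) (u, es) = 0"
    unfolding vanishing_on_long_walks_def by blast
  then have "agree_on_long_walks M p q" if "N \<le> M" for M
    using that unfolding agree_on_long_walks_def pull_diff by (metis eq_iff_diff_eq_0 le_trans)
  then show ?thesis unfolding eventually_sequentially by blast
qed

lemma left_inverse_matrix_agree_on_long_walks:
  assumes "finite A" "left_inverse_matrix K A B s t"
  shows "\<forall>\<^sub>F N in sequentially. \<forall>i\<in>A. \<forall>i'\<in>A.
    agree_on_long_walks N (\<Sum>j\<in>B. s i j * t j i') (unit_column i i')"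
  using assms unfolding left_inverse_matrix_def
  by (intro eventually_ball_finite ballI lpa_cong_agree_on_long_walks) auto

text \<open>
  Restricted to walks of lengths \<open>p i\<close> and \<open>q j\<close> ending at \<open>w\<close>, the action turns \<open>s\<close> and \<open>t\<close> into
  matrices over the field with \<open>s t = 1\<close>. Homogeneity of one of the two factors suffices: for an entry of the
  product whose source and target have the prescribed lengths, the intermediate walk then has the
  prescribed length, too.
\<close>

lemma inverse_matrices_imp_walk_count_le:
  fixes K :: "'k::field itself"
  assumes fin: "finite A" "finite B"
    and s: "\<And>i j. i \<in> A \<Longrightarrow> j \<in> B \<Longrightarrow> s i j \<in> carrier (lpa_free K G)"
    and t: "\<And>i j. i \<in> A \<Longrightarrow> j \<in> B \<Longrightarrow> t j i \<in> carrier (lpa_free K G)"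
    and hom: "(\<forall>i\<in>A. \<forall>j\<in>B. \<forall>a\<in>Poly_Mapping.keys (t j i). word_degree a = int (q j) - int (p i)) \<or>
      (\<forall>i\<in>A. \<forall>j\<in>B. \<forall>a\<in>Poly_Mapping.keys (s i j). word_degree a = int (p i) - int (q j))"
    and agree: "\<And>i i'. i \<in> A \<Longrightarrow> i' \<in> A \<Longrightarrow>
      agree_on_long_walks N (\<Sum>j\<in>B. s i j * t j i') (unit_column i i')"
    and large: "\<And>i. i \<in> A \<Longrightarrow> N \<le> p i"
  shows "(\<Sum>i\<in>A. card (walks_into w (p i))) \<le> (\<Sum>j\<in>B. card (walks_into w (q j)))"
proof -
  let ?P = "SIGMA i:A. walks_into w (p i)" and ?Q = "SIGMA j:B. walks_into w (q j)"
  let ?s = "\<lambda>(i, \<kappa>) (j, \<nu>). pull (indicator_of \<kappa> :: _ \<Rightarrow> 'k) (s i j) \<nu>"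
  let ?t = "\<lambda>(j, \<nu>) (i, \<mu>). pull (indicator_of \<nu> :: _ \<Rightarrow> 'k) (t j i) \<mu>"
  have "card ?P \<le> card ?Q"
  proof (rule right_invertible_family_card_le)
    show "finite ?P" "finite ?Q" using fin finite_walks_into by auto
  next
    fix x x' assume x: "x \<in> ?P" "x' \<in> ?P"
    obtain i v fs where x_eq: "x = (i, v, fs)" by (cases x) auto
    obtain i' u es where x'_eq: "x' = (i', u, es)" by (cases x') auto
    have i: "i \<in> A" "i' \<in> A" and vfs: "awalk v fs w" "length fs = p i"
      and ues: "awalk u es w" "length es = p i'"
      using x by (auto simp: x_eq x'_eq walks_into_def)
    let ?\<phi> = "indicator_of (v, fs) :: _ \<Rightarrow> 'k"
    have contract: "(\<Sum>\<nu>\<in>walks_into w (q j). pull ?\<phi> (s i j) \<nu> * pull (indicator_of \<nu>) (t j i') (u, es))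
       = pull ?\<phi> (s i j * t j i') (u, es)" if j: "j \<in> B" for j
      unfolding pull_mult
    proof (rule pull_expand[OF t[OF i(2) j] ues(1) finite_walks_into])
      fix u' es' a
      assume *: "a \<in> Poly_Mapping.keys (t j i')" "awalk u' es' w"
        "int (length es') = int (length es) + word_degree a" "(u', es') \<notin> walks_into w (q j)"
      have len: "length es' \<noteq> q j" using *(2,4) by (auto simp: walks_into_def)
      \<comment> \<open>If \<open>t\<close> is homogeneous, such a walk cannot be reached; if \<open>s\<close> is, it is not sent to \<open>(v, fs)\<close>.\<close>
      from hom show "pull ?\<phi> (s i j) (u', es') = 0"
      proof
        assume "\<forall>i\<in>A. \<forall>j\<in>B. \<forall>a\<in>Poly_Mapping.keys (t j i). word_degree a = int (q j) - int (p i)"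
        then have "word_degree a = int (q j) - int (p i')" using * i j by blast
        then show ?thesis using *(3) len ues(2) by simp
      next
        assume hs: "\<forall>i\<in>A. \<forall>j\<in>B. \<forall>a\<in>Poly_Mapping.keys (s i j). word_degree a = int (p i) - int (q j)"
        have "pull ?\<phi> (s i j) (u', es') = pull (\<lambda>_. 0) (s i j) (u', es')"
        proof (rule pull_local[OF s[OF i(1) j] *(2)])
          fix u'' :: 'a and es'' :: "'b list" and b assume "b \<in> Poly_Mapping.keys (s i j)"
            "int (length es'') = int (length es') + word_degree b"
          then have "int (length es'') = int (length es') + (int (p i) - int (q j))"
            using hs i j by auto
          then have "length es'' \<noteq> length fs" using len vfs(2) by linarith
          then show "?\<phi> (u'', es'') = 0" by (auto simp: indicator_of_def)
        qed
        then show ?thesis by simp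
      qed
    qed
    have "(\<Sum>y\<in>?Q. ?s x y * ?t y x')
        = (\<Sum>j\<in>B. \<Sum>\<nu>\<in>walks_into w (q j). pull ?\<phi> (s i j) \<nu> * pull (indicator_of \<nu>) (t j i') (u, es))"
      using fin finite_walks_into
      by (subst sum.Sigma) (auto simp: x_eq x'_eq case_prod_unfold)
    also have "\<dots> = pull ?\<phi> (\<Sum>j\<in>B. s i j * t j i') (u, es)"
      by (simp add: contract pull_sum)
    also have "\<dots> = pull ?\<phi> (unit_column i i') (u, es)"
      by (rule agree[OF i, unfolded agree_on_long_walks_def, rule_format, OF ues(1)]) (simp add: ues large i)
    also have "\<dots> = (if x = x' then 1 else 0)"
      unfolding pull_unit_column[OF ues(1)] by (auto simp: x_eq x'_eq indicator_of_def)
    finally show "(\<Sum>y\<in>?Q. ?s x y * ?t y x') = (if x = x' then 1 else 0)" .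
  qed
  then show ?thesis using fin finite_walks_into by (simp add: card_SigmaI)
qed

text \<open>
  The exponents are the shifts translated by a common \<open>k\<close>, large enough to make them nonnegative and to
  reach the walks on which all entries of both products agree with the identity matrix.
\<close>

lemma graded_isomorphic_imp_equal_walk_counts:
  fixes K :: "'k::field itself"
  assumes fin: "finite A" "finite B"
    and iso: "graded_isomorphic (LPA K) (free_module K A \<alpha>) (free_module K B \<beta>)"
  obtains p q where
    "\<And>w. (\<Sum>i\<in>A. card (walks_into w (p i))) = (\<Sum>j\<in>B. card (walks_into w (q j)))"
proof -
  obtain t s where t: "\<And>i j. i \<in> A \<Longrightarrow> j \<in> B \<Longrightarrow> t j i \<in> homogeneous K (\<beta> j - \<alpha> i)"
    and s: "\<And>i j. i \<in> A \<Longrightarrow> j \<in> B \<Longrightarrow> s i j \<in> nonunital K"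
    and inv: "left_inverse_matrix K A B s t" "left_inverse_matrix K B A t s"
    by (rule graded_isomorphic_imp_inverse_matrices[OF fin iso]) blast
  have "\<forall>\<^sub>F N in sequentially.
      (\<forall>i\<in>A. \<forall>i'\<in>A. agree_on_long_walks N (\<Sum>j\<in>B. s i j * t j i') (unit_column i i')) \<and>
      (\<forall>j\<in>B. \<forall>j'\<in>B. agree_on_long_walks N (\<Sum>i\<in>A. t j i * s i j') (unit_column j j'))"
    by (intro eventually_conj left_inverse_matrix_agree_on_long_walks[OF fin(1) inv(1)]
        left_inverse_matrix_agree_on_long_walks[OF fin(2) inv(2)])
  from eventually_happens'[OF sequentially_bot this] obtain N where N:
    "\<forall>i\<in>A. \<forall>i'\<in>A. agree_on_long_walks N (\<Sum>j\<in>B. s i j * t j i') (unit_column i i')"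
    "\<forall>j\<in>B. \<forall>j'\<in>B. agree_on_long_walks N (\<Sum>i\<in>A. t j i * s i j') (unit_column j j')"
    by (elim exE conjE)
  define k where "k = int N + (\<Sum>i\<in>A. \<bar>\<alpha> i\<bar>) + (\<Sum>j\<in>B. \<bar>\<beta> j\<bar>)"
  define p q where "p i = nat (k + \<alpha> i)" and "q j = nat (k + \<beta> j)" for i j
  have nonneg: "0 \<le> (\<Sum>i\<in>A. \<bar>\<alpha> i\<bar>)" "0 \<le> (\<Sum>j\<in>B. \<bar>\<beta> j\<bar>)" by (simp_all add: sum_nonneg)
  have p: "int N \<le> k + \<alpha> i" if "i \<in> A" for i
  proof -
    have "\<bar>\<alpha> i\<bar> \<le> (\<Sum>i\<in>A. \<bar>\<alpha> i\<bar>)" using fin that by (intro member_le_sum) auto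
    then show ?thesis unfolding k_def using nonneg by linarith
  qed
  have q: "int N \<le> k + \<beta> j" if "j \<in> B" for j
  proof -
    have "\<bar>\<beta> j\<bar> \<le> (\<Sum>j\<in>B. \<bar>\<beta> j\<bar>)" using fin that by (intro member_le_sum) auto
    then show ?thesis unfolding k_def using nonneg by linarith
  qed
  have pq: "int (p i) = k + \<alpha> i" "N \<le> p i" if "i \<in> A" for i using p[OF that] by (auto simp: p_def)
  have qq: "int (q j) = k + \<beta> j" "N \<le> q j" if "j \<in> B" for j using q[OF that] by (auto simp: q_def)
  have hom: "\<forall>i\<in>A. \<forall>j\<in>B. \<forall>a\<in>Poly_Mapping.keys (t j i). word_degree a = int (q j) - int (p i)"
    using t pq qq by (auto simp: homogeneous_def)
  have carr: "t j i \<in> carrier (lpa_free K G)" "s i j \<in> carrier (lpa_free K G)" if "i \<in> A" "j \<in> B" for i j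
    using t[OF that] s[OF that] by (auto intro: homogeneous_nonunital nonunital_carrier)
  have "(\<Sum>i\<in>A. card (walks_into w (p i))) = (\<Sum>j\<in>B. card (walks_into w (q j)))" for w
  proof (rule antisym)
    show "(\<Sum>i\<in>A. card (walks_into w (p i))) \<le> (\<Sum>j\<in>B. card (walks_into w (q j)))"
      using hom N(1)
      by (intro inverse_matrices_imp_walk_count_le[where s = s and t = t and N = N and K = K] fin carr pq(2))
        auto
    show "(\<Sum>j\<in>B. card (walks_into w (q j))) \<le> (\<Sum>i\<in>A. card (walks_into w (p i)))"
      using hom N(2)
      by (intro inverse_matrices_imp_walk_count_le[where s = t and t = s and N = N and K = K] fin carr qq(2))
        auto
  qed
  then show thesis using that by blast
qed

end

section \<open>Failure of graded invariant basis number\<close>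

theorem theorem3p6:
  fixes E :: "('v, 'e) pre_digraph" and vs :: "'v list"
  assumes "fin_digraph E"
    and "\<forall>v\<in>verts E. \<not> sink E v"
    and "distinct vs" and "set vs = verts E"
  shows "\<not> gr_IBN (leavitt_path_algebra TYPE('k::field) E) (lpa_grading TYPE('k) E) \<longleftrightarrow>
    (\<exists>(m::nat) (n::nat) (p :: nat \<Rightarrow> nat) (q :: nat \<Rightarrow> nat). 0 < m \<and> 0 < n \<and> m \<noteq> n \<and>
       ones_row (length vs) * power_sum_mat (adjacency_matrix E vs) m p =
       ones_row (length vs) * power_sum_mat (adjacency_matrix E vs) n q)"
    (is "?L \<longleftrightarrow> ?R")
proof -
  interpret fin_digraph E by fact
  note counts = ones_row_power_sum_eq_iff[OF assms(3,4)]
  show ?thesis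
  proof
    assume ?L
    then obtain m n and \<alpha> \<beta> :: "nat \<Rightarrow> int" where mn: "0 < m" "0 < n" "m \<noteq> n"
      and iso: "graded_isomorphic (LPA TYPE('k)) (free_module TYPE('k) {1..m} \<alpha>) (free_module TYPE('k) {1..n} \<beta>)"
      unfolding gr_IBN_def free_module_def by blast
    from graded_isomorphic_imp_equal_walk_counts[OF _ _ iso] obtain p q where
      "\<And>w. (\<Sum>i\<in>{1..m}. card (walks_into w (p i))) = (\<Sum>j\<in>{1..n}. card (walks_into w (q j)))" by auto
    then have "\<forall>w\<in>verts E. (\<Sum>i\<in>{1..m}. card (walks_into w (p i))) = (\<Sum>j\<in>{1..n}. card (walks_into w (q j)))"
      by blast
    then show ?R unfolding counts using mn by blast
  next
    assume ?R
    then obtain m n :: nat and p q :: "nat \<Rightarrow> nat" where mn: "0 < m" "0 < n" "m \<noteq> n"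
      and eq: "\<forall>w\<in>verts E. (\<Sum>i\<in>{1..m}. card (walks_into w (p i))) = (\<Sum>j\<in>{1..n}. card (walks_into w (q j)))"
      unfolding counts by blast
    have iso: "graded_isomorphic (LPA TYPE('k)) (free_module TYPE('k) {1..m} (\<lambda>i. int (p i)))
        (free_module TYPE('k) {1..n} (\<lambda>j. int (q j)))"
      using eq by (intro equal_walk_counts_imp_graded_isomorphic assms(2)) auto
    show ?L
    proof
      assume "gr_IBN (LPA TYPE('k)) (lpa_grading TYPE('k) E)"
      from this[unfolded gr_IBN_def, rule_format, OF mn(1,2) iso[unfolded free_module_def]] mn(3)
      show False by contradiction
    qed
  qed
qed

end
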